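(* If $\eta, \delta \in W$ satisfy $l(\eta\delta) = l(\eta) + l(\delta)$, then $[\eta]\ast[\delta] = [\eta\delta]$ in $\mathscr{H}_{\mathbb{Z}}(G, \mathscr{P}, 1)$.
   Context: Let $F$ be a non-archimedean local field with uniformizer $\varpi$ and residue field $\mathbb{F}_q$; $n = 2k$, $G = \operatorname{GL}_n(F)$, $\mathscr{P}$ the standard parahoric subgroup with reductive quotient $\operatorname{GL}_k(q)\times\operatorname{GL}_k(q)$. $\mathscr{H}_{\mathbb{Z}}(G, \mathscr{P}, 1)$ is the integral Hecke algebra of $\mathbb{Z}$-valued $\mathscr{P}$-bi-invariant compactly supported functions on $G$ under convolution, and $[\eta]$ denotes the characteristic function of $\mathscr{P}\eta\mathscr{P}$. $W$ is the subgroup of the affine Weyl group of $G$ generated by the block-scalar diagonal matrices $\operatorname{diag}(\varpi^a 1_k, \varpi^b 1_k)$ and $w = \left(\begin{smallmatrix} 0 & 1_k \\ 1_k & 0\end{smallmatrix}\right)$; it is isomorphic to the affine Weyl group of $\operatorname{GL}_2(F)$, and $l$ is the corresponding Coxeter length (with $l(w) = l(twt^{-1}) = 1$, $l(t) = 0$ for $t = \left(\begin{smallmatrix} 0 & 1_k \\ \varpi 1_k & 0\end{smallmatrix}\right)$). The restriction to $W$ of the length $l'$ of the affine Weyl group of $G$ is a positive constant multiple of $l$. *)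

theory Defs
  imports
    "HOL-Algebra.Generated_Groups"
    "HOL-Algebra.Left_Coset"
    "HOL-Analysis.Abstract_Topology"
    "HOL-Library.Indicator_Function"
    "Jordan_Normal_Form.Matrix"
begin

subsection \<open>Non-archimedean local fields\<close>

text \<open>
  A valuation is a function \<open>v :: 'a \<Rightarrow> int\<close> whose value at \<open>0\<close> is irrelevant;
  \<open>val_ge v m x\<close> says \<open>v x \<ge> m\<close> under the usual convention that the valuation of
  \<open>0\<close> is infinite.
\<close>

definition val_ge :: "('a::field \<Rightarrow> int) \<Rightarrow> int \<Rightarrow> 'a \<Rightarrow> bool" where
  "val_ge v m x \<longleftrightarrow> x = 0 \<or> m \<le> v x"

definition valuation_ring :: "('a::field \<Rightarrow> int) \<Rightarrow> 'a set" where
  "valuation_ring v = {x. val_ge v 0 x}"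

definition is_uniformizer :: "('a::field \<Rightarrow> int) \<Rightarrow> 'a \<Rightarrow> bool" where
  "is_uniformizer v \<pi> \<longleftrightarrow> \<pi> \<noteq> 0 \<and> v \<pi> = 1"

definition residue_rel :: "('a::field \<Rightarrow> int) \<Rightarrow> ('a \<times> 'a) set" where
  "residue_rel v =
     {(x, y). x \<in> valuation_ring v \<and> y \<in> valuation_ring v \<and> val_ge v 1 (x - y)}"

text \<open>
  A field that is complete with respect to a normalized discrete valuation and has finite
  residue field.
\<close>

locale nonarch_local_field =
  fixes v :: "'a::field \<Rightarrow> int"
  assumes v_mult: "x \<noteq> 0 \<Longrightarrow> y \<noteq> 0 \<Longrightarrow> v (x * y) = v x + v y"
    and v_add: "x \<noteq> 0 \<Longrightarrow> y \<noteq> 0 \<Longrightarrow> x + y \<noteq> 0 \<Longrightarrow> min (v x) (v y) \<le> v (x + y)"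
    and normalized: "\<exists>\<pi>. is_uniformizer v \<pi>"
    and complete:
      "(\<And>m. \<exists>N. \<forall>i\<ge>N. \<forall>j\<ge>N. val_ge v m (X i - X j)) \<Longrightarrow>
         \<exists>L. \<forall>m. \<exists>N. \<forall>i\<ge>N. val_ge v m (X (i::nat) - L)"
    and finite_residue_field: "finite (valuation_ring v // residue_rel v)"


subsection \<open>The group \<open>GL\<^sub>n(F)\<close> and its topology\<close>

definition GL :: "nat \<Rightarrow> 'a::field mat monoid" where
  "GL n = \<lparr>carrier = {A \<in> carrier_mat n n. invertible_mat A}, monoid.mult = (*), one = 1\<^sub>m n\<rparr>"

lemma GL_simps [simp]:
  "monoid.mult (GL n) = (*)" "one (GL n) = 1\<^sub>m n"
  by (simp_all add: GL_def)

lemma mem_GL_iff: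
  "A \<in> carrier (GL n) \<longleftrightarrow>
     A \<in> carrier_mat n n \<and> (\<exists>B \<in> carrier_mat n n. A * B = 1\<^sub>m n \<and> B * A = 1\<^sub>m n)"
proof
  assume A: "A \<in> carrier (GL n)"
  then have Ac: "A \<in> carrier_mat n n" by (simp add: GL_def)
  from A obtain B where B: "A * B = 1\<^sub>m n" "B * A = 1\<^sub>m (dim_row B)"
    by (auto simp: GL_def invertible_mat_def inverts_mat_def)
  have "dim_col (A * B) = n" "dim_col (B * A) = dim_row B"
    by (simp_all only: B) simp_all
  then have "B \<in> carrier_mat n n" using Ac by (intro carrier_matI) auto
  then show "A \<in> carrier_mat n n \<and> (\<exists>B \<in> carrier_mat n n. A * B = 1\<^sub>m n \<and> B * A = 1\<^sub>m n)"
    using Ac B by auto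
next
  assume "A \<in> carrier_mat n n \<and> (\<exists>B \<in> carrier_mat n n. A * B = 1\<^sub>m n \<and> B * A = 1\<^sub>m n)"
  then show "A \<in> carrier (GL n)"
    by (auto simp: GL_def invertible_mat_def inverts_mat_def)
qed

lemma group_GL: "group (GL n :: 'a::field mat monoid)"
proof (rule groupI)
  fix A B :: "'a mat" assume "A \<in> carrier (GL n)" "B \<in> carrier (GL n)"
  then obtain A' B' where c: "A \<in> carrier_mat n n" "B \<in> carrier_mat n n"
      "A' \<in> carrier_mat n n" "B' \<in> carrier_mat n n"
    and i: "A * A' = 1\<^sub>m n" "A' * A = 1\<^sub>m n" "B * B' = 1\<^sub>m n" "B' * B = 1\<^sub>m n"
    unfolding mem_GL_iff by auto
  have "(A * B) * (B' * A') = A * ((B * B') * A')"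
    using c by (simp add: assoc_mult_mat[of _ n n _ n _ n])
  moreover have "(B' * A') * (A * B) = B' * ((A' * A) * B)"
    using c by (simp add: assoc_mult_mat[of _ n n _ n _ n])
  ultimately have "(A * B) * (B' * A') = 1\<^sub>m n" "(B' * A') * (A * B) = 1\<^sub>m n"
    using c i by simp_all
  then show "A \<otimes>\<^bsub>GL n\<^esub> B \<in> carrier (GL n)"
    unfolding mem_GL_iff GL_simps using c by (meson mult_carrier_mat)
next
  fix A B C :: "'a mat"
  assume "A \<in> carrier (GL n)" "B \<in> carrier (GL n)" "C \<in> carrier (GL n)"
  then show "A \<otimes>\<^bsub>GL n\<^esub> B \<otimes>\<^bsub>GL n\<^esub> C = A \<otimes>\<^bsub>GL n\<^esub> (B \<otimes>\<^bsub>GL n\<^esub> C)"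
    by (simp add: mem_GL_iff assoc_mult_mat[of _ n n _ n _ n])
next
  fix A :: "'a mat" assume "A \<in> carrier (GL n)"
  then obtain B where "A \<in> carrier_mat n n" "B \<in> carrier_mat n n"
      "A * B = 1\<^sub>m n" "B * A = 1\<^sub>m n"
    unfolding mem_GL_iff by blast
  then have "B \<in> carrier (GL n) \<and> B \<otimes>\<^bsub>GL n\<^esub> A = \<one>\<^bsub>GL n\<^esub>"
    unfolding mem_GL_iff GL_simps by blast
  then show "\<exists>B \<in> carrier (GL n). B \<otimes>\<^bsub>GL n\<^esub> A = \<one>\<^bsub>GL n\<^esub>"
    by blast
qed (auto simp: mem_GL_iff)

text \<open>The subspace topology of the entrywise valuation topology on \<open>n \<times> n\<close> matrices.\<close>

definition GL_topology :: "('a::field \<Rightarrow> int) \<Rightarrow> nat \<Rightarrow> 'a mat topology" where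
  "GL_topology v n = topology (\<lambda>U. U \<subseteq> carrier (GL n) \<and>
     (\<forall>A\<in>U. \<exists>m. \<forall>B\<in>carrier (GL n).
        (\<forall>i<n. \<forall>j<n. val_ge v m (B $$ (i, j) - A $$ (i, j))) \<longrightarrow> B \<in> U))"

lemma openin_GL_topology:
  "openin (GL_topology v n) U \<longleftrightarrow> U \<subseteq> carrier (GL n) \<and>
     (\<forall>A\<in>U. \<exists>m. \<forall>B\<in>carrier (GL n).
        (\<forall>i<n. \<forall>j<n. val_ge v m (B $$ (i, j) - A $$ (i, j))) \<longrightarrow> B \<in> U)"
proof -
  define N where "N = (\<lambda>m A B. \<forall>i<n. \<forall>j<n. val_ge v m (B $$ (i, j) - A $$ (i, j)))"
  let ?O = "\<lambda>U. U \<subseteq> carrier (GL n) \<and> (\<forall>A\<in>U. \<exists>m. \<forall>B\<in>carrier (GL n). N m A B \<longrightarrow> B \<in> U)"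
  have mono: "N m A B" if "N m' A B" "m \<le> m'" for m m' A B
    using that unfolding N_def val_ge_def by (meson order_trans)
  have "?O (S \<inter> T)" if S: "?O S" and T: "?O T" for S T
  proof (intro conjI ballI)
    show "S \<inter> T \<subseteq> carrier (GL n)" using S by blast
    fix A assume A: "A \<in> S \<inter> T"
    from S A obtain m1 where m1: "\<forall>B\<in>carrier (GL n). N m1 A B \<longrightarrow> B \<in> S" by blast
    from T A obtain m2 where m2: "\<forall>B\<in>carrier (GL n). N m2 A B \<longrightarrow> B \<in> T" by blast
    have "B \<in> S \<inter> T" if "B \<in> carrier (GL n)" "N (max m1 m2) A B" for B
      using m1 m2 that mono[OF that(2), of m1] mono[OF that(2), of m2] by simp
    then show "\<exists>m. \<forall>B\<in>carrier (GL n). N m A B \<longrightarrow> B \<in> S \<inter> T" by blast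
  qed
  moreover have "?O (\<Union>K)" if K: "\<forall>S\<in>K. ?O S" for K
  proof (intro conjI ballI)
    show "\<Union>K \<subseteq> carrier (GL n)" using K by blast
    fix A assume "A \<in> \<Union>K"
    then obtain S where S: "S \<in> K" "A \<in> S" by blast
    with K obtain m where "\<forall>B\<in>carrier (GL n). N m A B \<longrightarrow> B \<in> S" by blast
    with S show "\<exists>m. \<forall>B\<in>carrier (GL n). N m A B \<longrightarrow> B \<in> \<Union>K" by blast
  qed
  ultimately have "istopology ?O"
    unfolding istopology_def by blast
  then show ?thesis
    unfolding GL_topology_def N_def by (rule fun_cong[OF topology_inverse'])
qed


subsection \<open>Integral Hecke algebras\<close>

text \<open>
  Functions on \<open>G\<close> are represented by functions on the ambient type that vanish outside
  the carrier.  The convolution is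
  \<open>(f * g)(x) = \<integral>\<^sub>G f(y) g(y\<^sup>-\<^sup>1 x) dy\<close> for the Haar measure giving \<open>P\<close> volume one.  For
  right \<open>P\<close>-invariant \<open>f\<close> and left \<open>P\<close>-invariant \<open>g\<close> the integrand is constant on each
  left coset \<open>y P\<close>, so the integral is the sum over \<open>G/P\<close> of its values at coset
  representatives.  As \<open>sum\<close> is zero on infinite index sets, the index set is cut down to
  the cosets in the support of \<open>f\<close>, which are finitely many if \<open>f\<close> has compact support
  and \<open>P\<close> is open.
\<close>

definition hecke_conv ::
    "('a, 'b) monoid_scheme \<Rightarrow> 'a set \<Rightarrow> ('a \<Rightarrow> int) \<Rightarrow> ('a \<Rightarrow> int) \<Rightarrow> 'a \<Rightarrow> int" where
  "hecke_conv G P f g x =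
     (if x \<in> carrier G
      then \<Sum>C \<in> {C \<in> lcosets\<^bsub>G\<^esub> P. \<exists>y\<in>C. f y \<noteq> 0}.
             (let y = SOME y. y \<in> C in f y * g (inv\<^bsub>G\<^esub> y \<otimes>\<^bsub>G\<^esub> x))
      else 0)"

definition double_coset :: "('a, 'b) monoid_scheme \<Rightarrow> 'a set \<Rightarrow> 'a \<Rightarrow> 'a set" where
  "double_coset G P \<eta> = P <#>\<^bsub>G\<^esub> (\<eta> <#\<^bsub>G\<^esub> P)"

definition hecke_char :: "('a, 'b) monoid_scheme \<Rightarrow> 'a set \<Rightarrow> 'a \<Rightarrow> 'a \<Rightarrow> int" where
  "hecke_char G P \<eta> = indicator (double_coset G P \<eta>)"

definition hecke_algebra ::
    "'a topology \<Rightarrow> ('a, 'b) monoid_scheme \<Rightarrow> 'a set \<Rightarrow> ('a \<Rightarrow> int) ring" where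
  "hecke_algebra T G P =
     \<lparr>carrier = {f. (\<forall>x. x \<notin> carrier G \<longrightarrow> f x = 0) \<and>
         (\<forall>x\<in>carrier G. \<forall>p\<in>P. \<forall>p'\<in>P. f (p \<otimes>\<^bsub>G\<^esub> x \<otimes>\<^bsub>G\<^esub> p') = f x) \<and>
         compactin T (T closure_of {x. f x \<noteq> 0})},
      monoid.mult = hecke_conv G P,
      one = hecke_char G P \<one>\<^bsub>G\<^esub>,
      zero = (\<lambda>_. 0),
      add = (\<lambda>f g x. f x + g x)\<rparr>"


subsection \<open>The parahoric subgroup and the group \<open>W\<close>\<close>

text \<open>
  Matrices in \<open>GL\<^sub>2\<^sub>k(\<O>)\<close> (that is, with both the matrix and its inverse integral) whose lower
  left \<open>k \<times> k\<close> block vanishes modulo the maximal ideal.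
\<close>

definition parahoric :: "('a::field \<Rightarrow> int) \<Rightarrow> nat \<Rightarrow> 'a mat set" where
  "parahoric v k = {A \<in> carrier (GL (2 * k)).
     (\<forall>i<2 * k. \<forall>j<2 * k. A $$ (i, j) \<in> valuation_ring v) \<and>
     (\<forall>i<2 * k. \<forall>j<2 * k. (inv\<^bsub>GL (2 * k)\<^esub> A) $$ (i, j) \<in> valuation_ring v) \<and>
     (\<forall>i\<in>{k..<2 * k}. \<forall>j<k. val_ge v 1 (A $$ (i, j)))}"

definition block_diag :: "'a::field \<Rightarrow> nat \<Rightarrow> int \<Rightarrow> int \<Rightarrow> 'a mat" where
  "block_diag \<pi> k a b = four_block_mat
     ((\<pi> powi a) \<cdot>\<^sub>m 1\<^sub>m k) (0\<^sub>m k k)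
     (0\<^sub>m k k) ((\<pi> powi b) \<cdot>\<^sub>m 1\<^sub>m k)"

definition w_mat :: "nat \<Rightarrow> 'a::field mat" where
  "w_mat k = four_block_mat (0\<^sub>m k k) (1\<^sub>m k) (1\<^sub>m k) (0\<^sub>m k k)"

definition t_mat :: "'a::field \<Rightarrow> nat \<Rightarrow> 'a mat" where
  "t_mat \<pi> k = four_block_mat (0\<^sub>m k k) (1\<^sub>m k) (\<pi> \<cdot>\<^sub>m 1\<^sub>m k) (0\<^sub>m k k)"

definition W :: "'a::field \<Rightarrow> nat \<Rightarrow> 'a mat set" where
  "W \<pi> k = generate (GL (2 * k)) (insert (w_mat k) {block_diag \<pi> k a b |a b. True})"

text \<open>
  \<open>W\<close> is the semidirect product of the Coxeter group generated by \<open>w\<close> and \<open>t w t\<^sup>-\<^sup>1\<close> with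
  the infinite cyclic group generated by \<open>t\<close>.  The length of an element is the word length
  of its Coxeter component with respect to these two simple reflections.
\<close>

definition simple_reflections :: "'a::field \<Rightarrow> nat \<Rightarrow> 'a mat set" where
  "simple_reflections \<pi> k =
     {w_mat k, t_mat \<pi> k \<otimes>\<^bsub>GL (2 * k)\<^esub> w_mat k \<otimes>\<^bsub>GL (2 * k)\<^esub> inv\<^bsub>GL (2 * k)\<^esub> (t_mat \<pi> k)}"

definition W_length :: "'a::field \<Rightarrow> nat \<Rightarrow> 'a mat \<Rightarrow> nat" where
  "W_length \<pi> k \<eta> = (LEAST m. \<exists>ss (j::int).
     length ss = m \<and> set ss \<subseteq> simple_reflections \<pi> k \<and>
     \<eta> = foldr (\<otimes>\<^bsub>GL (2 * k)\<^esub>) ss \<one>\<^bsub>GL (2 * k)\<^esub>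
           \<otimes>\<^bsub>GL (2 * k)\<^esub> (t_mat \<pi> k [^]\<^bsub>GL (2 * k)\<^esub> j))"

end

theory Submission
  imports Defs "Jordan_Normal_Form.Determinant"
begin

text \<open>
  Write \<open>D(a,b) = diag(\<pi>\<^sup>a, \<pi>\<^sup>b)\<close>. Since \<open>t D(a,b) t\<^sup>-\<^sup>1 = D(b,a)\<close> and \<open>t\<^sup>2 = D(1,1)\<close>, every
  element of \<open>W\<close> is of the form \<open>t\<^sup>i D(a,b)\<close>, of length \<open>|a - b|\<close>. As \<open>t\<close> normalizes \<open>P\<close>, lengths
  that add up reduce the claim to \<open>\<eta> = D(a,b)\<close> and \<open>\<delta> = D(c,d)\<close> with \<open>a \<le> b\<close> and \<open>c \<le> d\<close>. There the
  factorization of \<open>P\<close> into lower unipotent times upper block triangular matrices shows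
  \<open>\<eta> P \<delta> \<subseteq> P \<eta> \<delta> P\<close>, as conjugation by \<open>\<eta>\<close> shrinks the lower and conjugation by \<open>\<delta>\<^sup>-\<^sup>1\<close> the
  upper part. All coefficients are one because \<open>\<eta>\<^sup>-\<^sup>1 P \<eta> P\<close> only has poles in the lower left block
  and \<open>\<delta> P \<delta>\<^sup>-\<^sup>1 P\<close> only in the upper row, so that the two meet in \<open>P\<close>.
\<close>

section \<open>Products of double cosets\<close>

text \<open>
  \<open>factors_through\<close> says \<open>P = (P \<inter> \<eta>\<^sup>-\<^sup>1 P \<eta>) (P \<inter> \<delta> P \<delta>\<^sup>-\<^sup>1)\<close>, which gives the support of
  \<open>[\<eta>] * [\<delta>]\<close>; \<open>meets_trivially\<close> says \<open>\<eta>\<^sup>-\<^sup>1 P \<eta> \<inter> \<delta> P \<delta>\<^sup>-\<^sup>1 P \<subseteq> P\<close>, which bounds its coefficients.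
\<close>

definition factors_through :: "('a, 'b) monoid_scheme \<Rightarrow> 'a set \<Rightarrow> 'a \<Rightarrow> 'a \<Rightarrow> bool" where
  "factors_through G P \<eta> \<delta> \<longleftrightarrow> (\<forall>p\<in>P. \<exists>a\<in>P. \<exists>b\<in>P. p = a \<otimes>\<^bsub>G\<^esub> b \<and>
     \<eta> \<otimes>\<^bsub>G\<^esub> a \<otimes>\<^bsub>G\<^esub> inv\<^bsub>G\<^esub> \<eta> \<in> P \<and> inv\<^bsub>G\<^esub> \<delta> \<otimes>\<^bsub>G\<^esub> b \<otimes>\<^bsub>G\<^esub> \<delta> \<in> P)"

definition meets_trivially :: "('a, 'b) monoid_scheme \<Rightarrow> 'a set \<Rightarrow> 'a \<Rightarrow> 'a \<Rightarrow> bool" where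
  "meets_trivially G P \<eta> \<delta> \<longleftrightarrow> (\<forall>p\<in>P. \<forall>q\<in>P. \<forall>r\<in>P.
     inv\<^bsub>G\<^esub> \<eta> \<otimes>\<^bsub>G\<^esub> p \<otimes>\<^bsub>G\<^esub> \<eta> = \<delta> \<otimes>\<^bsub>G\<^esub> q \<otimes>\<^bsub>G\<^esub> inv\<^bsub>G\<^esub> \<delta> \<otimes>\<^bsub>G\<^esub> r \<longrightarrow> inv\<^bsub>G\<^esub> \<eta> \<otimes>\<^bsub>G\<^esub> p \<otimes>\<^bsub>G\<^esub> \<eta> \<in> P)"

text \<open>Both inclusions are demanded because a one-sided inclusion of a conjugate of
  \<open>P\<close> in \<open>P\<close> may be proper. Together they describe the normalizer of
  \<open>P\<close>, which is closed under inverses.\<close>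

definition normalizing :: "('a, 'b) monoid_scheme \<Rightarrow> 'a set \<Rightarrow> 'a set" where
  "normalizing G P = {n \<in> carrier G. \<forall>p\<in>P.
     n \<otimes>\<^bsub>G\<^esub> p \<otimes>\<^bsub>G\<^esub> inv\<^bsub>G\<^esub> n \<in> P \<and> inv\<^bsub>G\<^esub> n \<otimes>\<^bsub>G\<^esub> p \<otimes>\<^bsub>G\<^esub> n \<in> P}"

context group
begin

lemma mem_double_coset_iff:
  "x \<in> double_coset G P \<eta> \<longleftrightarrow> (\<exists>p\<in>P. \<exists>q\<in>P. x = p \<otimes> (\<eta> \<otimes> q))"
  by (auto simp: double_coset_def set_mult_def l_coset_def)

lemma l_coset_absorb:
  assumes P: "subgroup P G" and "x \<in> carrier G" "p \<in> P"
  shows "(x \<otimes> p) <# P = x <# P"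
  using assms by (metis lcos_m_assoc subgroup.mem_carrier subgroup.subset coset_join3)

lemma eq_l_coset_of_mem:
  assumes P: "subgroup P G" and "C \<in> lcosets P" "y \<in> C"
  shows "C = y <# P" "y \<in> carrier G"
proof -
  obtain x where x: "x \<in> carrier G" "C = x <# P" using assms by (auto simp: LCOSETS_def)
  then obtain p where p: "p \<in> P" "y = x \<otimes> p" using assms by (auto simp: l_coset_def)
  show "C = y <# P" using l_coset_absorb[OF P x(1) p(1)] x p by simp
  show "y \<in> carrier G" using x p subgroup.mem_carrier[OF P] by simp
qed

lemma inv_cancel:
  assumes "x \<in> carrier G" "y \<in> carrier G"
  shows "inv x \<otimes> (x \<otimes> y) = y" "x \<otimes> (inv x \<otimes> y) = y"
  using assms by (simp_all add: m_assoc[symmetric])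

text \<open>The value of the convolution at \<open>x\<close> counts the cosets \<open>y P\<close> in
  \<open>P \<eta> P\<close> with \<open>inv y \<otimes> x\<close> in \<open>P \<delta> P\<close>. By
  \<open>fact\<close>, \<eta> P \<delta> lies in P \<eta> \<delta> P, so the count vanishes off that
  double coset; on it, \<open>meet\<close> leaves exactly one coset. Finiteness matters because
  \<open>sum\<close> over an infinite set is zero.\<close>

lemma hecke_conv_double_coset:
  assumes P: "subgroup P G" and \<eta>: "\<eta> \<in> carrier G" and \<delta>: "\<delta> \<in> carrier G"
    and fin: "finite {C \<in> lcosets P. C \<inter> double_coset G P \<eta> \<noteq> {}}"
    and fact: "factors_through G P \<eta> \<delta>" and meet: "meets_trivially G P \<eta> \<delta>"
  shows "hecke_conv G P (hecke_char G P \<eta>) (hecke_char G P \<delta>) = hecke_char G P (\<eta> \<otimes> \<delta>)"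
proof
  fix x
  note Pc = subgroup.mem_carrier[OF P]
  have Pm: "p \<otimes> q \<in> P" "inv p \<in> P" if "p \<in> P" "q \<in> P" for p q
    using that P by (auto simp: subgroup.m_closed subgroup.m_inv_closed)
  note gs = m_assoc inv_mult_group inv_cancel
  let ?I = "{C \<in> lcosets P. \<exists>y\<in>C. hecke_char G P \<eta> y \<noteq> 0}"
  let ?y = "\<lambda>C. SOME y. y \<in> C"
  have I: "?I = {C \<in> lcosets P. C \<inter> double_coset G P \<eta> \<noteq> {}}"
    by (auto simp: hecke_char_def indicator_def)
  \<comment> \<open>The index set only says that \<open>C\<close> meets the double coset of \<eta>.
    Its invariance under right multiplication by \<open>P\<close> puts the representative chosen in
    \<open>hecke_conv\<close> into it as well.\<close>
  have y: "?y C \<in> C" "?y C \<in> carrier G" "C = ?y C <# P" "?y C \<in> double_coset G P \<eta>"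
    if CI: "C \<in> ?I" for C
  proof -
    obtain z where z: "z \<in> C" "z \<in> double_coset G P \<eta>" "C \<in> lcosets P"
      using CI unfolding I by blast
    show 1: "?y C \<in> C" using z(1) by (rule someI)
    show 2: "?y C \<in> carrier G" "C = ?y C <# P"
      using eq_l_coset_of_mem[OF P z(3) 1] by auto
    have "C = z <# P" using eq_l_coset_of_mem[OF P z(3,1)] by auto
    with 1 obtain p where p: "p \<in> P" "?y C = z \<otimes> p" by (auto simp: l_coset_def)
    from z obtain a b where ab: "a \<in> P" "b \<in> P" "z = a \<otimes> (\<eta> \<otimes> b)"
      by (auto simp: mem_double_coset_iff)
    have "?y C = a \<otimes> (\<eta> \<otimes> (b \<otimes> p))" using p ab \<eta> Pc by (simp add: m_assoc)
    then show "?y C \<in> double_coset G P \<eta>"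
      using ab p Pm by (auto simp: mem_double_coset_iff)
  qed
  show "hecke_conv G P (hecke_char G P \<eta>) (hecke_char G P \<delta>) x = hecke_char G P (\<eta> \<otimes> \<delta>) x"
  proof (cases "x \<in> carrier G")
    case False
    then have "x \<notin> double_coset G P (\<eta> \<otimes> \<delta>)"
      using \<eta> \<delta> Pc by (auto simp: mem_double_coset_iff)
    with False show ?thesis by (simp add: hecke_conv_def hecke_char_def)
  next
    case x: True
    have sum: "hecke_conv G P (hecke_char G P \<eta>) (hecke_char G P \<delta>) x
        = (\<Sum>C\<in>?I. hecke_char G P \<delta> (inv (?y C) \<otimes> x))"
      using x y by (auto simp: hecke_conv_def hecke_char_def Let_def intro!: sum.cong)
    show ?thesis
    proof (cases "x \<in> double_coset G P (\<eta> \<otimes> \<delta>)")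
      case False
      have "inv (?y C) \<otimes> x \<notin> double_coset G P \<delta>" if C: "C \<in> ?I" for C
      proof
        assume "inv (?y C) \<otimes> x \<in> double_coset G P \<delta>"
        then obtain c d where cd: "c \<in> P" "d \<in> P" "inv (?y C) \<otimes> x = c \<otimes> (\<delta> \<otimes> d)"
          by (auto simp: mem_double_coset_iff)
        obtain a b where ab: "a \<in> P" "b \<in> P" "?y C = a \<otimes> (\<eta> \<otimes> b)"
          using y(4)[OF C] by (auto simp: mem_double_coset_iff)
        \<comment> \<open>The inner element \<open>b \<otimes> c\<close> is split so that
          \<open>e\<close> can be moved to the left past \<eta> and \<open>f\<close> to the right
          past \<delta>, both staying in \<open>P\<close>.\<close>
        obtain e f where ef: "e \<in> P" "f \<in> P" "b \<otimes> c = e \<otimes> f"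
            "\<eta> \<otimes> e \<otimes> inv \<eta> \<in> P" "inv \<delta> \<otimes> f \<otimes> \<delta> \<in> P"
          using fact Pm(1)[OF ab(2) cd(1)] unfolding factors_through_def by blast
        have "x = ?y C \<otimes> (inv (?y C) \<otimes> x)"
          using x y(2)[OF C] by (simp add: gs)
        also have "\<dots> = a \<otimes> (\<eta> \<otimes> b) \<otimes> (c \<otimes> (\<delta> \<otimes> d))"
          by (simp only: cd(3)) (simp only: ab(3))
        also have "\<dots> = a \<otimes> (\<eta> \<otimes> ((b \<otimes> c) \<otimes> (\<delta> \<otimes> d)))"
          using ab(1,2) cd(1,2) \<eta> \<delta> Pc by (simp add: m_assoc)
        also have "\<dots> = (a \<otimes> (\<eta> \<otimes> e \<otimes> inv \<eta>)) \<otimes> ((\<eta> \<otimes> \<delta>) \<otimes> ((inv \<delta> \<otimes> f \<otimes> \<delta>) \<otimes> d))"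
          unfolding ef(3) using ab(1,2) cd(1,2) ef(1,2) \<eta> \<delta> Pc by (simp add: gs)
        finally have "x \<in> double_coset G P (\<eta> \<otimes> \<delta>)"
          unfolding mem_double_coset_iff using Pm(1)[OF ab(1) ef(4)] Pm(1)[OF ef(5) cd(2)] by blast
        with False show False ..
      qed
      then have "(\<Sum>C\<in>?I. hecke_char G P \<delta> (inv (?y C) \<otimes> x)) = 0"
        by (intro sum.neutral) (auto simp: hecke_char_def)
      with sum False show ?thesis by (simp add: hecke_char_def)
    next
      case True
      then obtain p p' where p: "p \<in> P" "p' \<in> P" "x = p \<otimes> ((\<eta> \<otimes> \<delta>) \<otimes> p')"
        by (auto simp: mem_double_coset_iff)
      \<comment> \<open>Writing x = (p \<eta>) (\<delta> p') exhibits one contributing coset; the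
        rest shows that there is no other.\<close>
      define C0 where "C0 = (p \<otimes> \<eta>) <# P"
      have p\<eta>: "p \<otimes> \<eta> \<in> C0" "p \<otimes> \<eta> \<in> carrier G"
        unfolding C0_def using p \<eta> P Pc by (auto intro!: lcos_self)
      have "p \<otimes> \<eta> = p \<otimes> (\<eta> \<otimes> \<one>)" using \<eta> by simp
      then have "p \<otimes> \<eta> \<in> double_coset G P \<eta>"
        unfolding mem_double_coset_iff using p subgroup.one_closed[OF P] by blast
      then have C0: "C0 \<in> ?I"
        using p\<eta> unfolding I by (auto simp: LCOSETS_def C0_def)
      have iff: "inv (?y C) \<otimes> x \<in> double_coset G P \<delta> \<longleftrightarrow> C = C0" if C: "C \<in> ?I" for C
      proof
        assume "C = C0"
        then have "?y C \<in> (p \<otimes> \<eta>) <# P" using y(1)[OF C] by (simp add: C0_def)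
        then obtain r where r: "r \<in> P" "?y C = p \<otimes> \<eta> \<otimes> r" by (auto simp: l_coset_def)
        have "inv (?y C) \<otimes> x = inv r \<otimes> (\<delta> \<otimes> p')"
          unfolding r(2) p(3) using r(1) p(1,2) \<eta> \<delta> Pc by (simp add: gs)
        then show "inv (?y C) \<otimes> x \<in> double_coset G P \<delta>"
          unfolding mem_double_coset_iff using Pm(2)[OF r(1) r(1)] p(2) by blast
      next
        assume "inv (?y C) \<otimes> x \<in> double_coset G P \<delta>"
        then obtain c d where cd: "c \<in> P" "d \<in> P" "inv (?y C) \<otimes> x = c \<otimes> (\<delta> \<otimes> d)"
          by (auto simp: mem_double_coset_iff)
        obtain a b where ab: "a \<in> P" "b \<in> P" "?y C = a \<otimes> (\<eta> \<otimes> b)"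
          using y(4)[OF C] by (auto simp: mem_double_coset_iff)
        \<comment> \<open>\<open>?X\<close> compares the representative of \<open>C\<close> with
          that of \<open>C0\<close>: \<open>?y C\<close> equals p \<eta> \<open>?X\<close> b. The
          two expressions for \<open>x\<close> give \<open>?X\<close> = \<open>?Y\<close> times an
          element of \<open>P\<close>, which is the situation of
          \<open>meets_trivially\<close>.\<close>
        let ?X = "inv \<eta> \<otimes> (inv p \<otimes> a) \<otimes> \<eta>"
        let ?Y = "\<delta> \<otimes> (p' \<otimes> inv d) \<otimes> inv \<delta>"
        have "x = ?y C \<otimes> (inv (?y C) \<otimes> x)"
          using x y(2)[OF C] by (simp add: gs)
        also have "\<dots> = a \<otimes> (\<eta> \<otimes> b) \<otimes> (c \<otimes> (\<delta> \<otimes> d))"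
          by (simp only: cd(3)) (simp only: ab(3))
        finally have x': "p \<otimes> ((\<eta> \<otimes> \<delta>) \<otimes> p') = a \<otimes> (\<eta> \<otimes> (b \<otimes> (c \<otimes> (\<delta> \<otimes> d))))"
          unfolding p(3) using ab(1,2) cd(1,2) \<eta> \<delta> Pc by (simp add: m_assoc)
        have "\<delta> \<otimes> p' = inv \<eta> \<otimes> (inv p \<otimes> (p \<otimes> ((\<eta> \<otimes> \<delta>) \<otimes> p')))"
          using p(1,2) \<eta> \<delta> Pc by (simp add: gs)
        then have \<delta>p: "\<delta> \<otimes> p' = ?X \<otimes> (b \<otimes> (c \<otimes> (\<delta> \<otimes> d)))"
          unfolding x' using p(1,2) ab(1,2) cd(1,2) \<eta> \<delta> Pc by (simp add: m_assoc)
        have Xc: "?X \<in> carrier G" using p(1) ab(1) \<eta> Pc by simp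
        have "?Y \<otimes> inv (b \<otimes> c) = (\<delta> \<otimes> p') \<otimes> (inv d \<otimes> (inv \<delta> \<otimes> (inv c \<otimes> inv b)))"
          using p(1,2) ab(1,2) cd(1,2) \<eta> \<delta> Pc by (simp add: gs)
        also have "\<dots> = ?X \<otimes> ((b \<otimes> (c \<otimes> (\<delta> \<otimes> d))) \<otimes> (inv d \<otimes> (inv \<delta> \<otimes> (inv c \<otimes> inv b))))"
          unfolding \<delta>p using Xc p(1,2) ab(1,2) cd(1,2) \<eta> \<delta> Pc by (simp only: m_assoc m_closed inv_closed)
        also have "\<dots> = ?X"
          using Xc p(1,2) ab(1,2) cd(1,2) \<eta> \<delta> Pc by (simp add: gs)
        finally have "?X = ?Y \<otimes> inv (b \<otimes> c)" ..
        then have XP: "?X \<in> P"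
          using meet Pm p(1,2) ab(1,2) cd(1,2) unfolding meets_trivially_def by blast
        have "?y C = (p \<otimes> \<eta>) \<otimes> (?X \<otimes> b)"
          unfolding ab(3) using p(1,2) ab(1,2) \<eta> Pc by (simp add: gs)
        then show "C = C0"
          using y(3)[OF C] l_coset_absorb[OF P p\<eta>(2) Pm(1)[OF XP ab(2)]] by (simp add: C0_def)
      qed
      have "(\<Sum>C\<in>?I. hecke_char G P \<delta> (inv (?y C) \<otimes> x)) = (\<Sum>C\<in>?I. if C = C0 then 1 else 0)"
        using iff by (intro sum.cong) (auto simp: hecke_char_def indicator_def)
      also have "\<dots> = 1" using C0 fin unfolding I by simp
      finally show ?thesis using sum True by (simp add: hecke_char_def)
    qed
  qed
qed

section \<open>Multiplication by elements of the normalizer of \<open>P\<close>\<close>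

lemma subgroup_normalizing:
  assumes P: "subgroup P G"
  shows "subgroup (normalizing G P) G"
proof
  note Pc = subgroup.mem_carrier[OF P]
  show "normalizing G P \<subseteq> carrier G" by (auto simp: normalizing_def)
  show "\<one> \<in> normalizing G P" using Pc by (auto simp: normalizing_def)
  show "inv n \<in> normalizing G P" if "n \<in> normalizing G P" for n
    using that by (auto simp: normalizing_def)
  show "m \<otimes> n \<in> normalizing G P" if "m \<in> normalizing G P" "n \<in> normalizing G P" for m n
  proof -
    have mn: "m \<in> carrier G" "n \<in> carrier G" using that by (auto simp: normalizing_def)
    have "m \<otimes> n \<otimes> p \<otimes> inv (m \<otimes> n) \<in> P \<and> inv (m \<otimes> n) \<otimes> p \<otimes> (m \<otimes> n) \<in> P" if p: "p \<in> P" for p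
    proof -
      have "m \<otimes> n \<otimes> p \<otimes> inv (m \<otimes> n) = m \<otimes> (n \<otimes> p \<otimes> inv n) \<otimes> inv m"
        "inv (m \<otimes> n) \<otimes> p \<otimes> (m \<otimes> n) = inv n \<otimes> (inv m \<otimes> p \<otimes> m) \<otimes> n"
        using mn Pc[OF p] by (simp_all add: m_assoc inv_mult_group)
      then show ?thesis
        using \<open>m \<in> normalizing G P\<close> \<open>n \<in> normalizing G P\<close> p by (auto simp: normalizing_def)
    qed
    with mn show ?thesis by (auto simp: normalizing_def)
  qed
qed

text \<open>The factorization of m p m^-1 is conjugated back by \<open>m\<close>; the outer factors
  \<open>l\<close> and \<open>n\<close> merely conjugate elements already known to be in
  \<open>P\<close>. The inner \<open>m\<close> and \<open>inv m\<close> cancel in the product of the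
  two arguments.\<close>

lemma factors_through_normalizing:
  assumes P: "subgroup P G" and c: "\<eta> \<in> carrier G" "\<delta> \<in> carrier G"
    and n: "l \<in> normalizing G P" "m \<in> normalizing G P" "n \<in> normalizing G P"
    and fact: "factors_through G P \<eta> \<delta>"
  shows "factors_through G P (l \<otimes> \<eta> \<otimes> m) (inv m \<otimes> \<delta> \<otimes> n)"
  unfolding factors_through_def
proof
  fix p assume p: "p \<in> P"
  note Pc = subgroup.mem_carrier[OF P]
  have nc: "l \<in> carrier G" "m \<in> carrier G" "n \<in> carrier G"
    using n by (auto simp: normalizing_def)
  have nP: "k \<otimes> q \<otimes> inv k \<in> P" "inv k \<otimes> q \<otimes> k \<in> P" if "k \<in> {l, m, n}" "q \<in> P" for k q
    using n that by (auto simp: normalizing_def)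
  obtain a b where ab: "a \<in> P" "b \<in> P" "m \<otimes> p \<otimes> inv m = a \<otimes> b"
      "\<eta> \<otimes> a \<otimes> inv \<eta> \<in> P" "inv \<delta> \<otimes> b \<otimes> \<delta> \<in> P"
    using fact nP(1)[of m p] p unfolding factors_through_def by blast
  let ?a = "inv m \<otimes> a \<otimes> m" and ?b = "inv m \<otimes> b \<otimes> m"
  note gs = m_assoc inv_mult_group inv_cancel
  have "p = inv m \<otimes> (m \<otimes> p \<otimes> inv m) \<otimes> m" using nc Pc[OF p] by (simp add: gs)
  then have "p = ?a \<otimes> ?b" unfolding ab(3) using nc Pc ab(1,2) by (simp add: gs)
  moreover have "l \<otimes> \<eta> \<otimes> m \<otimes> ?a \<otimes> inv (l \<otimes> \<eta> \<otimes> m) = l \<otimes> (\<eta> \<otimes> a \<otimes> inv \<eta>) \<otimes> inv l"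
    using nc c Pc ab(1,2) by (simp add: gs)
  moreover have "inv (inv m \<otimes> \<delta> \<otimes> n) \<otimes> ?b \<otimes> (inv m \<otimes> \<delta> \<otimes> n) = inv n \<otimes> (inv \<delta> \<otimes> b \<otimes> \<delta>) \<otimes> n"
    using nc c Pc ab(1,2) by (simp add: gs)
  ultimately show "\<exists>a\<in>P. \<exists>b\<in>P. p = a \<otimes> b \<and> l \<otimes> \<eta> \<otimes> m \<otimes> a \<otimes> inv (l \<otimes> \<eta> \<otimes> m) \<in> P \<and>
      inv (inv m \<otimes> \<delta> \<otimes> n) \<otimes> b \<otimes> (inv m \<otimes> \<delta> \<otimes> n) \<in> P"
    using nP ab by (intro bexI[of _ ?a] bexI[of _ ?b]) auto
qed

text \<open>Conjugating the equation by \<open>m\<close> turns it into one for \<eta> and \<delta>,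
  with \<open>p\<close>, \<open>q\<close>, \<open>r\<close> replaced by their conjugates under
  \<open>l\<close>, \<open>n\<close>, \<open>m\<close>.\<close>

lemma meets_trivially_normalizing:
  assumes P: "subgroup P G" and c: "\<eta> \<in> carrier G" "\<delta> \<in> carrier G"
    and n: "l \<in> normalizing G P" "m \<in> normalizing G P" "n \<in> normalizing G P"
    and meet: "meets_trivially G P \<eta> \<delta>"
  shows "meets_trivially G P (l \<otimes> \<eta> \<otimes> m) (inv m \<otimes> \<delta> \<otimes> n)"
  unfolding meets_trivially_def
proof (intro ballI impI)
  fix p q r assume p: "p \<in> P" "q \<in> P" "r \<in> P"
    and eq: "inv (l \<otimes> \<eta> \<otimes> m) \<otimes> p \<otimes> (l \<otimes> \<eta> \<otimes> m) = inv m \<otimes> \<delta> \<otimes> n \<otimes> q \<otimes> inv (inv m \<otimes> \<delta> \<otimes> n) \<otimes> r"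
  note Pc = subgroup.mem_carrier[OF P]
  have nc: "l \<in> carrier G" "m \<in> carrier G" "n \<in> carrier G"
    using n by (auto simp: normalizing_def)
  have nP: "k \<otimes> q \<otimes> inv k \<in> P" "inv k \<otimes> q \<otimes> k \<in> P" if "k \<in> {l, m, n}" "q \<in> P" for k q
    using n that by (auto simp: normalizing_def)
  note gs = m_assoc inv_mult_group inv_cancel
  let ?p = "inv l \<otimes> p \<otimes> l" and ?q = "n \<otimes> q \<otimes> inv n" and ?r = "m \<otimes> r \<otimes> inv m"
  have "inv \<eta> \<otimes> ?p \<otimes> \<eta> = m \<otimes> (inv (l \<otimes> \<eta> \<otimes> m) \<otimes> p \<otimes> (l \<otimes> \<eta> \<otimes> m)) \<otimes> inv m"
    using nc c Pc p by (simp add: gs)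
  also have "\<dots> = \<delta> \<otimes> ?q \<otimes> inv \<delta> \<otimes> ?r"
    unfolding eq using nc c Pc p by (simp add: gs)
  finally have "inv \<eta> \<otimes> ?p \<otimes> \<eta> \<in> P"
    using meet nP p unfolding meets_trivially_def by blast
  then have "inv m \<otimes> (inv \<eta> \<otimes> ?p \<otimes> \<eta>) \<otimes> m \<in> P" using nP by blast
  moreover have "inv m \<otimes> (inv \<eta> \<otimes> ?p \<otimes> \<eta>) \<otimes> m = inv (l \<otimes> \<eta> \<otimes> m) \<otimes> p \<otimes> (l \<otimes> \<eta> \<otimes> m)"
    using nc c Pc p by (simp add: gs)
  ultimately show "inv (l \<otimes> \<eta> \<otimes> m) \<otimes> p \<otimes> (l \<otimes> \<eta> \<otimes> m) \<in> P" by simp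
qed

text \<open>By the hypothesis on \<open>F\<close>, the cosets x \<eta> P with \<open>x\<close> in
  \<open>F\<close> cover P \<eta> P. Pulling \<open>l\<close> out to the left and \<open>m\<close>
  to the right shows that the cosets of l x \<eta> m cover the new double coset.\<close>

lemma finite_double_coset_normalizing:
  assumes P: "subgroup P G" and c: "\<eta> \<in> carrier G"
    and n: "l \<in> normalizing G P" "m \<in> normalizing G P"
    and F: "finite F" "F \<subseteq> carrier G" "\<And>p. p \<in> P \<Longrightarrow> \<exists>x\<in>F. \<exists>q\<in>P. p \<otimes> \<eta> = x \<otimes> \<eta> \<otimes> q"
  shows "finite {C \<in> lcosets P. C \<inter> double_coset G P (l \<otimes> \<eta> \<otimes> m) \<noteq> {}}"
proof (rule finite_subset)
  note Pc = subgroup.mem_carrier[OF P]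
  have nc: "l \<in> carrier G" "m \<in> carrier G"
    using n by (auto simp: normalizing_def)
  have nP: "k \<otimes> q \<otimes> inv k \<in> P" "inv k \<otimes> q \<otimes> k \<in> P" if "k \<in> {l, m}" "q \<in> P" for k q
    using n that by (auto simp: normalizing_def)
  note gs = m_assoc inv_mult_group inv_cancel
  show "finite ((\<lambda>x. (l \<otimes> x \<otimes> \<eta> \<otimes> m) <# P) ` F)" using F by simp
  show "{C \<in> lcosets P. C \<inter> double_coset G P (l \<otimes> \<eta> \<otimes> m) \<noteq> {}}
      \<subseteq> (\<lambda>x. (l \<otimes> x \<otimes> \<eta> \<otimes> m) <# P) ` F"
  proof
    fix C assume "C \<in> {C \<in> lcosets P. C \<inter> double_coset G P (l \<otimes> \<eta> \<otimes> m) \<noteq> {}}"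
    then obtain y where y: "y \<in> C" "C \<in> lcosets P" "y \<in> double_coset G P (l \<otimes> \<eta> \<otimes> m)" by blast
    then obtain a b where ab: "a \<in> P" "b \<in> P" "y = a \<otimes> (l \<otimes> \<eta> \<otimes> m \<otimes> b)"
      by (auto simp: mem_double_coset_iff)
    let ?a = "inv l \<otimes> a \<otimes> l"
    obtain x q where xq: "x \<in> F" "q \<in> P" "?a \<otimes> \<eta> = x \<otimes> \<eta> \<otimes> q"
      using F(3)[OF nP(2)[of l a]] ab by blast
    have xc: "x \<in> carrier G" using xq F by blast
    have "y = l \<otimes> (?a \<otimes> \<eta>) \<otimes> m \<otimes> b" unfolding ab(3) using c nc Pc ab(1,2) by (simp add: gs)
    also have "\<dots> = (l \<otimes> x \<otimes> \<eta> \<otimes> m) \<otimes> ((inv m \<otimes> q \<otimes> m) \<otimes> b)"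
      unfolding xq(3) using c nc Pc ab(1,2) xq(2) xc by (simp add: gs)
    finally have "y <# P = (l \<otimes> x \<otimes> \<eta> \<otimes> m) <# P"
      using l_coset_absorb[OF P, of "l \<otimes> x \<otimes> \<eta> \<otimes> m" "(inv m \<otimes> q \<otimes> m) \<otimes> b"] c nc xc nP(2)[of m q]
        xq(2) ab(2) subgroup.m_closed[OF P] by auto
    with eq_l_coset_of_mem(1)[OF P y(2,1)] xq(1)
    show "C \<in> (\<lambda>x. (l \<otimes> x \<otimes> \<eta> \<otimes> m) <# P) ` F" by blast
  qed
qed

end

section \<open>Integral matrices\<close>

context nonarch_local_field
begin

section \<open>Rules for valuations\<close>

lemma v_one: "v 1 = 0"
  using v_mult[of 1 1] by simp

lemma v_uminus: "v (- x) = v x"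
proof (cases "x = 0")
  case False
  \<comment> \<open>The square of -1 is 1, so twice its valuation is zero.\<close>
  have "v (-1) = 0" using v_mult[of "-1" "-1"] v_one by simp
  then show ?thesis using v_mult[of "-1" x] False by simp
qed simp

lemma val_ge_zero [simp]: "val_ge v m 0"
  by (simp add: val_ge_def)

lemma val_ge_one [simp]: "val_ge v m 1 \<longleftrightarrow> m \<le> 0"
  by (simp add: val_ge_def v_one)

lemma val_ge_mono: "val_ge v m x \<Longrightarrow> m' \<le> m \<Longrightarrow> val_ge v m' x"
  by (auto simp: val_ge_def)

lemma val_ge_mult: "val_ge v m x \<Longrightarrow> val_ge v m' y \<Longrightarrow> val_ge v (m + m') (x * y)"
  by (cases "x = 0"; cases "y = 0") (auto simp: val_ge_def v_mult)

lemma val_ge_add: "val_ge v m x \<Longrightarrow> val_ge v m y \<Longrightarrow> val_ge v m (x + y)"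
  using v_add[of x y] by (cases "x = 0"; cases "y = 0"; cases "x + y = 0") (auto simp: val_ge_def)

lemma val_ge_uminus [simp]: "val_ge v m (- x) \<longleftrightarrow> val_ge v m x"
  by (simp add: val_ge_def v_uminus)

lemma val_ge_sum: "(\<And>i. i \<in> I \<Longrightarrow> val_ge v m (f i)) \<Longrightarrow> val_ge v m (sum f I)"
  by (induction I rule: infinite_finite_induct) (auto intro: val_ge_add)

lemma val_ge_prod: "(\<And>i. i \<in> I \<Longrightarrow> val_ge v 0 (f i)) \<Longrightarrow> val_ge v 0 (prod f I)"
proof (induction I rule: infinite_finite_induct)
  case (insert i I)
  then show ?case using val_ge_mult[of 0 "f i" 0 "prod f I"] by simp
qed auto

text \<open>The factors are exchanged one at a time; each exchange changes the product by a multiple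
  of \<open>f i - g i\<close> with integral cofactor.\<close>

lemma val_ge_prod_diff:
  assumes "\<And>i. i \<in> I \<Longrightarrow> val_ge v 0 (f i)" "\<And>i. i \<in> I \<Longrightarrow> val_ge v 0 (g i)"
    "\<And>i. i \<in> I \<Longrightarrow> val_ge v m (f i - g i)"
  shows "val_ge v m (prod f I - prod g I)"
  using assms
proof (induction I rule: infinite_finite_induct)
  case (insert i I)
  have "prod f (insert i I) - prod g (insert i I)
      = (f i - g i) * prod f I + g i * (prod f I - prod g I)"
    using insert by (simp add: algebra_simps)
  moreover have "val_ge v m ((f i - g i) * prod f I)"
    using val_ge_mult[of m "f i - g i" 0 "prod f I"] val_ge_prod[of I f] insert by simp
  moreover have "val_ge v m (g i * (prod f I - prod g I))"
    using val_ge_mult[of 0 "g i" m "prod f I - prod g I"] insert by simp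
  ultimately show ?case by (simp add: val_ge_add)
qed auto

section \<open>Determinants and inverses of integral matrices\<close>

lemma val_ge_signof: "val_ge v 0 (signof p :: 'a)"
  by (simp add: sign_def)

text \<open>In the Leibniz formula each product changes only by valuation at least \<open>m\<close>,
  by \<open>val_ge_prod_diff\<close>, and signs are integral.\<close>

lemma val_ge_det_diff:
  assumes A: "A \<in> carrier_mat n n" and B: "B \<in> carrier_mat n n"
    and "\<And>i j. i < n \<Longrightarrow> j < n \<Longrightarrow> val_ge v 0 (A $$ (i, j))"
    and "\<And>i j. i < n \<Longrightarrow> j < n \<Longrightarrow> val_ge v 0 (B $$ (i, j))"
    and "\<And>i j. i < n \<Longrightarrow> j < n \<Longrightarrow> val_ge v m (A $$ (i, j) - B $$ (i, j))"
  shows "val_ge v m (det A - det B)"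
proof -
  let ?P = "{p. p permutes {0..<n}}"
  let ?d = "\<lambda>p. (\<Prod>i = 0..<n. A $$ (i, p i)) - (\<Prod>i = 0..<n. B $$ (i, p i))"
  have "val_ge v m (?d p)" if "p \<in> ?P" for p
  proof (rule val_ge_prod_diff)
    fix i assume "i \<in> {0..<n}"
    moreover from this have "p i < n"
      using that permutes_in_image[of p "{0..<n}" i] by auto
    ultimately show "val_ge v 0 (A $$ (i, p i))" "val_ge v 0 (B $$ (i, p i))"
      "val_ge v m (A $$ (i, p i) - B $$ (i, p i))"
      using assms by auto
  qed
  then have "val_ge v m (signof p * ?d p)" if "p \<in> ?P" for p
    using val_ge_mult[OF val_ge_signof[of p], of m "?d p"] that by simp
  then have "val_ge v m (\<Sum>p\<in>?P. signof p * ?d p)"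
    by (rule val_ge_sum)
  also have "(\<Sum>p\<in>?P. signof p * ?d p) = det A - det B"
    by (simp add: det_def'[OF A] det_def'[OF B] sum_subtractf right_diff_distrib)
  finally show ?thesis .
qed

lemma val_ge_det:
  assumes A: "A \<in> carrier_mat n n" and "\<And>i j. i < n \<Longrightarrow> j < n \<Longrightarrow> val_ge v 0 (A $$ (i, j))"
  shows "val_ge v 0 (det A)"
  unfolding det_def'[OF A]
proof (rule val_ge_sum)
  fix p assume p: "p \<in> {p. p permutes {0..<n}}"
  have "val_ge v 0 (\<Prod>i = 0..<n. A $$ (i, p i))"
    using assms p permutes_in_image[of p "{0..<n}"] by (intro val_ge_prod) auto
  from val_ge_mult[OF val_ge_signof[of p] this]
  show "val_ge v 0 (signof p * (\<Prod>i = 0..<n. A $$ (i, p i)))" by simp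
qed

text \<open>For an integral matrix the hypothesis \<open>det\<close> says that the determinant is a
  unit of the valuation ring. The inverse is then integral by the adjugate formula, cofactors being
  determinants of integral matrices.\<close>

lemma integral_inverse:
  assumes A: "A \<in> carrier_mat n n" and int: "\<And>i j. i < n \<Longrightarrow> j < n \<Longrightarrow> val_ge v 0 (A $$ (i, j))"
    and det: "\<not> val_ge v 1 (det A)"
  obtains A' where "A' \<in> carrier_mat n n" "A * A' = 1\<^sub>m n" "A' * A = 1\<^sub>m n"
    "\<And>i j. i < n \<Longrightarrow> j < n \<Longrightarrow> val_ge v 0 (A' $$ (i, j))"
proof
  let ?A = "inverse (det A) \<cdot>\<^sub>m adj_mat A"
  note adj = adj_mat[OF A]
  have d: "det A \<noteq> 0" "v (det A) = 0"
    using det val_ge_det[OF A int] by (auto simp: val_ge_def)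
  show "?A \<in> carrier_mat n n" using adj by simp
  show "A * ?A = 1\<^sub>m n" "?A * A = 1\<^sub>m n"
    using adj A d by (auto simp: mult_smult_distrib[OF A adj(1)] mult_smult_assoc_mat[OF adj(1) A])
  have "v (inverse (det A)) = 0"
    using v_mult[of "det A" "inverse (det A)"] d v_one by simp
  then have di: "val_ge v 0 (inverse (det A))" by (simp add: val_ge_def)
  fix i j assume ij: "i < n" "j < n"
  have "val_ge v 0 (det (mat_delete A j i))"
  proof (rule val_ge_det)
    show "mat_delete A j i \<in> carrier_mat (n - 1) (n - 1)" by (rule mat_delete_carrier[OF A])
    show "val_ge v 0 (mat_delete A j i $$ (a, b))" if "a < n - 1" "b < n - 1" for a b
      using A int that by (auto simp: mat_delete_def)
  qed
  then have "val_ge v 0 (adj_mat A $$ (i, j))"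
    using ij A by (cases "even (j + i)") (auto simp: adj_mat_def cofactor_def)
  from val_ge_mult[OF di this] show "val_ge v 0 (?A $$ (i, j))"
    using ij adj(1) by simp
qed

end

section \<open>Block matrices\<close>

definition entries_ge :: "('a::field \<Rightarrow> int) \<Rightarrow> int \<Rightarrow> 'a mat \<Rightarrow> bool" where
  "entries_ge v m A \<longleftrightarrow> (\<forall>i<dim_row A. \<forall>j<dim_col A. val_ge v m (A $$ (i, j)))"

text \<open>Lower bounds \<open>a, b, c, d\<close> for the valuations in the blocks \<open>((A, B), (C, D))\<close> of a matrix.\<close>

definition block_ge :: "('a::field \<Rightarrow> int) \<Rightarrow> nat \<Rightarrow> int \<Rightarrow> int \<Rightarrow> int \<Rightarrow> int \<Rightarrow> 'a mat \<Rightarrow> bool" where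
  "block_ge v k a b c d X \<longleftrightarrow> X \<in> carrier_mat (2 * k) (2 * k) \<and>
     (\<forall>i<2 * k. \<forall>j<2 * k.
        val_ge v (if i < k then if j < k then a else b else if j < k then c else d) (X $$ (i, j)))"

lemma obtain_blocks:
  assumes "X \<in> carrier_mat (2 * k) (2 * k)"
  obtains A B C E where "A \<in> carrier_mat k k" "B \<in> carrier_mat k k" "C \<in> carrier_mat k k"
    "E \<in> carrier_mat k k" "X = four_block_mat A B C E"
proof -
  obtain A B C E where s: "split_block X k k = (A, B, C, E)" by (metis prod_cases4)
  show ?thesis using split_block[OF s, of k k] assms that by (auto simp: mult_2)
qed

lemma four_block_mat_inject:
  assumes c: "A \<in> carrier_mat k k" "B \<in> carrier_mat k k" "C \<in> carrier_mat k k" "E \<in> carrier_mat k k"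
    "A' \<in> carrier_mat k k" "B' \<in> carrier_mat k k" "C' \<in> carrier_mat k k" "E' \<in> carrier_mat k k"
    and eq: "four_block_mat A B C E = four_block_mat A' B' C' E'"
  shows "A = A'" "B = B'" "C = C'" "E = E'"
proof -
  have e: "four_block_mat A B C E $$ (i, j) = four_block_mat A' B' C' E' $$ (i, j)" for i j
    using eq by simp
  show "A = A'"
  proof (rule eq_matI)
    show "A $$ (i, j) = A' $$ (i, j)" if "i < dim_row A'" "j < dim_col A'" for i j
      using e[of i j] that c by auto
  qed (use c in auto)
  show "B = B'"
  proof (rule eq_matI)
    show "B $$ (i, j) = B' $$ (i, j)" if "i < dim_row B'" "j < dim_col B'" for i j
      using e[of i "k + j"] that c by auto
  qed (use c in auto)
  show "C = C'"
  proof (rule eq_matI)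
    show "C $$ (i, j) = C' $$ (i, j)" if "i < dim_row C'" "j < dim_col C'" for i j
      using e[of "k + i" j] that c by auto
  qed (use c in auto)
  show "E = E'"
  proof (rule eq_matI)
    show "E $$ (i, j) = E' $$ (i, j)" if "i < dim_row E'" "j < dim_col E'" for i j
      using e[of "k + i" "k + j"] that c by auto
  qed (use c in auto)
qed

lemma block_ge_four_block_mat:
  assumes "A \<in> carrier_mat k k" "B \<in> carrier_mat k k" "C \<in> carrier_mat k k" "E \<in> carrier_mat k k"
  shows "block_ge v k a b c d (four_block_mat A B C E) \<longleftrightarrow>
    entries_ge v a A \<and> entries_ge v b B \<and> entries_ge v c C \<and> entries_ge v d E" (is "?l = ?r")
proof
  assume l: ?l
  have "val_ge v (if i < k then if j < k then a else b else if j < k then c else d)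
      (four_block_mat A B C E $$ (i, j))" if "i < 2 * k" "j < 2 * k" for i j
    using l that by (simp add: block_ge_def)
  note h = this
  show ?r
    unfolding entries_ge_def
  proof (intro conjI allI impI)
    fix i j assume "i < dim_row A" "j < dim_col A"
    then show "val_ge v a (A $$ (i, j))" using h[of i j] assms by auto
  next
    fix i j assume "i < dim_row B" "j < dim_col B"
    then show "val_ge v b (B $$ (i, j))" using h[of i "k + j"] assms by auto
  next
    fix i j assume "i < dim_row C" "j < dim_col C"
    then show "val_ge v c (C $$ (i, j))" using h[of "k + i" j] assms by auto
  next
    fix i j assume "i < dim_row E" "j < dim_col E"
    then show "val_ge v d (E $$ (i, j))" using h[of "k + i" "k + j"] assms by auto
  qed
next
  assume ?r
  then show ?l
    using assms by (auto simp: block_ge_def entries_ge_def mult_2)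
qed

lemma block_geE:
  assumes "block_ge v k a b c d X"
  obtains A B C E where "A \<in> carrier_mat k k" "B \<in> carrier_mat k k" "C \<in> carrier_mat k k"
    "E \<in> carrier_mat k k" "X = four_block_mat A B C E"
    "entries_ge v a A" "entries_ge v b B" "entries_ge v c C" "entries_ge v d E"
proof -
  have "X \<in> carrier_mat (2 * k) (2 * k)" using assms by (simp add: block_ge_def)
  then obtain A B C E where *: "A \<in> carrier_mat k k" "B \<in> carrier_mat k k" "C \<in> carrier_mat k k"
    "E \<in> carrier_mat k k" "X = four_block_mat A B C E" by (rule obtain_blocks)
  show ?thesis using that[OF *] assms block_ge_four_block_mat[OF *(1-4)] *(5) by blast
qed

lemma block_ge_carrier: "block_ge v k a b c d X \<Longrightarrow> X \<in> carrier_mat (2 * k) (2 * k)"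
  by (simp add: block_ge_def)

lemma block_geD:
  assumes "block_ge v k a b c d X" "i < 2 * k" "j < 2 * k"
  shows "val_ge v (if i < k then if j < k then a else b else if j < k then c else d) (X $$ (i, j))"
  using assms by (simp add: block_ge_def)

text \<open>Two expressions for the same matrix may control different blocks; this merges a lower
  left bound from the second with the other bounds from the first.\<close>

lemma block_ge_combine:
  assumes "block_ge v k a b c d X" "block_ge v k a' b' c' d' X"
  shows "block_ge v k a b c' d X"
  unfolding block_ge_def
proof (intro conjI allI impI)
  show "X \<in> carrier_mat (2 * k) (2 * k)" using assms by (simp add: block_ge_def)
  fix i j assume "i < 2 * k" "j < 2 * k"
  then show "val_ge v (if i < k then if j < k then a else b else if j < k then c' else d) (X $$ (i, j))"
    using block_geD[OF assms(1), of i j] block_geD[OF assms(2), of i j] by (simp split: if_splits)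
qed

lemma eq_uminus_of_add_eq_zero_mat:
  fixes A :: "'a::ring_1 mat"
  assumes c: "A \<in> carrier_mat n m" "B \<in> carrier_mat n m" and 0: "A + B = 0\<^sub>m n m"
  shows "A = - B"
proof (rule eq_matI)
  fix i j assume ij: "i < dim_row (- B)" "j < dim_col (- B)"
  have "(A + B) $$ (i, j) = 0" unfolding 0 using ij c by simp
  then show "A $$ (i, j) = (- B) $$ (i, j)"
    using ij c by (simp add: eq_neg_iff_add_eq_0)
qed (use c in auto)

context nonarch_local_field
begin

lemma entries_ge_mono: "entries_ge v m A \<Longrightarrow> m' \<le> m \<Longrightarrow> entries_ge v m' A"
  by (auto simp: entries_ge_def intro: val_ge_mono)

lemma entries_ge_add:
  assumes "A \<in> carrier_mat k n" "B \<in> carrier_mat k n" "entries_ge v m A" "entries_ge v m B"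
  shows "entries_ge v m (A + B)"
  using assms by (auto simp: entries_ge_def intro!: val_ge_add)

lemma entries_ge_mult:
  assumes "A \<in> carrier_mat k l" "B \<in> carrier_mat l n" "entries_ge v m A" "entries_ge v m' B"
  shows "entries_ge v (m + m') (A * B)"
  using assms by (auto simp: entries_ge_def scalar_prod_def intro!: val_ge_sum val_ge_mult)

lemma entries_ge_uminus: "entries_ge v m A \<Longrightarrow> entries_ge v m (- A)"
  by (auto simp: entries_ge_def)

lemma entries_ge_smult: "val_ge v m x \<Longrightarrow> entries_ge v m (x \<cdot>\<^sub>m 1\<^sub>m k)"
  by (auto simp: entries_ge_def)

lemma entries_ge_zero: "entries_ge v m (0\<^sub>m k n)"
  by (auto simp: entries_ge_def)

lemma entries_ge_one: "entries_ge v 0 (1\<^sub>m k)"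
  by (auto simp: entries_ge_def)

lemma block_ge_mono:
  assumes "block_ge v k a b c d X" "a' \<le> a" "b' \<le> b" "c' \<le> c" "d' \<le> d"
  shows "block_ge v k a' b' c' d' X"
  unfolding block_ge_def
proof (intro conjI allI impI)
  show "X \<in> carrier_mat (2 * k) (2 * k)" using assms by (simp add: block_ge_def)
  fix i j assume ij: "i < 2 * k" "j < 2 * k"
  show "val_ge v (if i < k then if j < k then a' else b' else if j < k then c' else d') (X $$ (i, j))"
    by (rule val_ge_mono[OF block_geD[OF assms(1) ij]]) (use assms in auto)
qed

lemma block_ge_mult:
  assumes X: "block_ge v k a b c d X" and Y: "block_ge v k a' b' c' d' Y"
    and "a'' \<le> a + a'" "a'' \<le> b + c'" "b'' \<le> a + b'" "b'' \<le> b + d'"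
    and "c'' \<le> c + a'" "c'' \<le> d + c'" "d'' \<le> c + b'" "d'' \<le> d + d'"
  shows "block_ge v k a'' b'' c'' d'' (X * Y)"
proof -
  obtain A B C E where X: "A \<in> carrier_mat k k" "B \<in> carrier_mat k k" "C \<in> carrier_mat k k"
    "E \<in> carrier_mat k k" "X = four_block_mat A B C E"
    "entries_ge v a A" "entries_ge v b B" "entries_ge v c C" "entries_ge v d E"
    using X by (rule block_geE)
  obtain A' B' C' E' where Y: "A' \<in> carrier_mat k k" "B' \<in> carrier_mat k k" "C' \<in> carrier_mat k k"
    "E' \<in> carrier_mat k k" "Y = four_block_mat A' B' C' E'"
    "entries_ge v a' A'" "entries_ge v b' B'" "entries_ge v c' C'" "entries_ge v d' E'"
    using Y by (rule block_geE)
  have m: "entries_ge v m (Q * R + Q' * R')"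
    if "Q \<in> carrier_mat k k" "R \<in> carrier_mat k k" "Q' \<in> carrier_mat k k" "R' \<in> carrier_mat k k"
      "entries_ge v q Q" "entries_ge v r R" "entries_ge v q' Q'" "entries_ge v r' R'"
      "m \<le> q + r" "m \<le> q' + r'" for m q r q' r' Q R Q' R'
    using entries_ge_add[of "Q * R" k k "Q' * R'" m] that
      entries_ge_mono[OF entries_ge_mult[of Q k k R k q r]]
      entries_ge_mono[OF entries_ge_mult[of Q' k k R' k q' r']] by simp
  show ?thesis
    unfolding X(5) Y(5) mult_four_block_mat[OF X(1-4) Y(1-4)]
    using X(1-4) Y(1-4)
      m[OF X(1) Y(1) X(2) Y(3) X(6) Y(6) X(7) Y(8) assms(3,4)]
      m[OF X(1) Y(2) X(2) Y(4) X(6) Y(7) X(7) Y(9) assms(5,6)]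
      m[OF X(3) Y(1) X(4) Y(3) X(8) Y(6) X(9) Y(8) assms(7,8)]
      m[OF X(3) Y(2) X(4) Y(4) X(8) Y(7) X(9) Y(9) assms(9,10)]
    by (subst block_ge_four_block_mat) simp_all
qed

text \<open>
  Modulo the maximal ideal the determinant of an integral block matrix with lower left block
  congruent to zero is the product of the determinants of its diagonal blocks.
\<close>

lemma upper_left_block_invertible:
  assumes c: "A \<in> carrier_mat k k" "B \<in> carrier_mat k k" "C \<in> carrier_mat k k" "E \<in> carrier_mat k k"
    and X: "block_ge v k 0 0 1 0 (four_block_mat A B C E)"
    and Y: "block_ge v k 0 0 0 0 Y" "four_block_mat A B C E * Y = 1\<^sub>m (2 * k)"
  obtains A' where "A' \<in> carrier_mat k k" "A * A' = 1\<^sub>m k" "A' * A = 1\<^sub>m k" "entries_ge v 0 A'"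
proof -
  \<comment> \<open>\<open>?U\<close> has the same entries as \<open>?X\<close> modulo the maximal
    ideal, but its determinant is exactly the product of those of \<open>A\<close> and
    \<open>E\<close>.\<close>
  let ?X = "four_block_mat A B C E" and ?U = "four_block_mat A B (0\<^sub>m k k) E"
  have X0: "block_ge v k 0 0 1 0 ?U"
    using X c by (simp add: block_ge_four_block_mat entries_ge_zero)
  have Xc: "?X \<in> carrier_mat (2 * k) (2 * k)" "?U \<in> carrier_mat (2 * k) (2 * k)"
    using X X0 by (auto dest: block_ge_carrier)
  have int: "val_ge v 0 (Z $$ (i, j))" if "i < 2 * k" "j < 2 * k" "block_ge v k 0 0 0 0 Z" for i j Z
    using block_geD[OF that(3,1,2)] by simp
  have X': "block_ge v k 0 0 0 0 ?X" "block_ge v k 0 0 0 0 ?U"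
    using block_ge_mono[OF X, of 0 0 0 0] block_ge_mono[OF X0, of 0 0 0 0] by auto
  have Yc: "Y \<in> carrier_mat (2 * k) (2 * k)" using Y(1) by (rule block_ge_carrier)
  have AE: "val_ge v 0 (A $$ (i, j))" "val_ge v 0 (E $$ (i, j))" if "i < k" "j < k" for i j
    using X c that by (auto simp: block_ge_four_block_mat entries_ge_def)
  have C1: "val_ge v 1 (C $$ (i, j))" if "i < k" "j < k" for i j
    using X c that by (auto simp: block_ge_four_block_mat entries_ge_def)
  have "val_ge v 1 (det ?X - det ?U)"
  proof (rule val_ge_det_diff[OF Xc])
    fix i j assume ij: "i < 2 * k" "j < 2 * k"
    show "val_ge v 0 (?X $$ (i, j))" by (rule int[OF ij X'(1)])
    show "val_ge v 0 (?U $$ (i, j))" by (rule int[OF ij X'(2)])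
    show "val_ge v 1 (?X $$ (i, j) - ?U $$ (i, j))" using ij c C1 by auto
  qed
  moreover have "det ?U = det A * det E"
    using c by (intro det_four_block_mat_lower_left_zero) auto
  ultimately have diff: "val_ge v 1 (det ?X - det A * det E)" by simp
  \<comment> \<open>Otherwise \<open>det ?X\<close> would lie in the maximal ideal, whereas
    \<open>det ?X * det Y = 1\<close> with \<open>det Y\<close> integral.\<close>
  have "\<not> val_ge v 1 (det A)"
  proof
    assume "val_ge v 1 (det A)"
    then have "val_ge v 1 (det A * det E)"
      using val_ge_mult[of 1 "det A" 0 "det E"] val_ge_det[OF c(4) AE(2)] by simp
    then have "val_ge v 1 (det ?X)" using val_ge_add[OF diff, of "det A * det E"] by simp
    moreover have "val_ge v 0 (det Y)" using val_ge_det[OF Yc int[OF _ _ Y(1)]] .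
    ultimately have "val_ge v 1 (det ?X * det Y)" using val_ge_mult[of 1 "det ?X" 0 "det Y"] by simp
    moreover have "det ?X * det Y = 1" using det_mult[OF Xc(1) Yc] Y(2) by simp
    ultimately show False by simp
  qed
  then obtain A' where "A' \<in> carrier_mat k k" "A * A' = 1\<^sub>m k" "A' * A = 1\<^sub>m k"
    "\<And>i j. i < k \<Longrightarrow> j < k \<Longrightarrow> val_ge v 0 (A' $$ (i, j))"
    using integral_inverse[OF c(1) AE(1)] by blast
  then show ?thesis using that[of A'] by (simp add: entries_ge_def)
qed

text \<open>The lower left block of Y X = 1 reads C' A + E' C = 0. As \<open>A\<close> is invertible
  over the valuation ring, C' = - E' C A^-1 inherits the divisibility of \<open>C\<close>. Thus the
  condition in \<open>parahoric\<close> on the lower left block passes to the inverse.\<close>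

lemma lower_left_block_inverse:
  assumes X: "block_ge v k 0 0 1 0 X" and Y: "block_ge v k 0 0 0 0 Y"
    and inv: "X * Y = 1\<^sub>m (2 * k)" "Y * X = 1\<^sub>m (2 * k)"
  shows "block_ge v k 0 0 1 0 Y"
proof -
  obtain A B C E where XX: "A \<in> carrier_mat k k" "B \<in> carrier_mat k k" "C \<in> carrier_mat k k"
    "E \<in> carrier_mat k k" "X = four_block_mat A B C E"
    "entries_ge v 0 A" "entries_ge v 0 B" "entries_ge v 1 C" "entries_ge v 0 E"
    using X by (rule block_geE)
  obtain A' B' C' E' where YY: "A' \<in> carrier_mat k k" "B' \<in> carrier_mat k k" "C' \<in> carrier_mat k k"
    "E' \<in> carrier_mat k k" "Y = four_block_mat A' B' C' E'"
    "entries_ge v 0 A'" "entries_ge v 0 B'" "entries_ge v 0 C'" "entries_ge v 0 E'"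
    using Y by (rule block_geE)
  obtain Z where Z: "Z \<in> carrier_mat k k" "A * Z = 1\<^sub>m k" "entries_ge v 0 Z"
    using upper_left_block_invertible[OF XX(1-4) X[unfolded XX(5)] Y inv(1)[unfolded XX(5)]] by blast
  have "four_block_mat (A' * A + B' * C) (A' * B + B' * E) (C' * A + E' * C) (C' * B + E' * E)
      = four_block_mat (1\<^sub>m k) (0\<^sub>m k k) (0\<^sub>m k k) (1\<^sub>m k)"
    using inv(2) unfolding XX(5) YY(5) mult_four_block_mat[OF YY(1-4) XX(1-4)]
    by (simp only: four_block_one_mat mult_2)
  then have 0: "C' * A + E' * C = 0\<^sub>m k k"
    by (rule four_block_mat_inject(3)[rotated 8]) (use XX(1-4) YY(1-4) in auto)
  have "C' + E' * C * Z = C' * (A * Z) + E' * C * Z" unfolding Z(2) using YY(3) by simp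
  also have "\<dots> = C' * A * Z + E' * C * Z"
    using assoc_mult_mat[OF YY(3) XX(1) Z(1)] by simp
  also have "\<dots> = (C' * A + E' * C) * Z"
    using XX(1,3) YY(3,4) Z(1) by (intro add_mult_distrib_mat[symmetric]) auto
  also have "\<dots> = 0\<^sub>m k k" unfolding 0 using Z(1) by simp
  finally have "C' + E' * C * Z = 0\<^sub>m k k" .
  then have "C' = - (E' * C * Z)"
    using XX(1-4) YY(1-4) Z(1) by (intro eq_uminus_of_add_eq_zero_mat[of _ k k]) auto
  moreover have "entries_ge v 1 (E' * C * Z)"
    using entries_ge_mult[of "E' * C" k k Z k 1 0] entries_ge_mult[of E' k k C k 0 1]
      XX(3,8) YY(4,9) Z(1,3) by simp
  ultimately have "entries_ge v 1 C'" by (simp add: entries_ge_uminus)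
  then show ?thesis unfolding YY(5) using YY by (simp add: block_ge_four_block_mat)
qed

end

section \<open>The parahoric subgroup and its normalizer\<close>

lemma smult_one_mult [simp]:
  fixes x y :: "'a::comm_ring_1"
  shows "(x \<cdot>\<^sub>m 1\<^sub>m k) * (y \<cdot>\<^sub>m 1\<^sub>m k) = (x * y) \<cdot>\<^sub>m 1\<^sub>m k"
proof -
  have "x \<cdot>\<^sub>m (y \<cdot>\<^sub>m 1\<^sub>m k) = (x * y) \<cdot>\<^sub>m (1\<^sub>m k :: 'a mat)"
    by (rule eq_matI) auto
  then show ?thesis by (simp add: mult_smult_assoc_mat[of _ k k _ k])
qed

lemma one_smult_mat [simp]: "(1 :: 'a::comm_ring_1) \<cdot>\<^sub>m A = A"
  by (rule eq_matI) auto

locale parahoric_setting = nonarch_local_field v for v :: "'a::field \<Rightarrow> int" +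
  fixes \<pi> :: 'a and k :: nat
  assumes uniformizer: "is_uniformizer v \<pi>" and k_pos: "0 < k"
begin

sublocale G: group "GL (2 * k) :: 'a mat monoid"
  rewrites "monoid.mult (GL (2 * k) :: 'a mat monoid) = (*)"
    and "one (GL (2 * k) :: 'a mat monoid) = 1\<^sub>m (2 * k)"
  by (rule group_GL) simp_all

abbreviation "G \<equiv> GL (2 * k) :: 'a mat monoid"
abbreviation "P \<equiv> parahoric v k"
abbreviation "D a b \<equiv> block_diag \<pi> k a b"
abbreviation "t \<equiv> t_mat \<pi> k"

lemma \<pi>_nonzero: "\<pi> \<noteq> 0" and v_\<pi>: "v \<pi> = 1"
  using uniformizer by (auto simp: is_uniformizer_def)

lemma v_inverse: "x \<noteq> 0 \<Longrightarrow> v (inverse x) = - v x"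
  using v_mult[of x "inverse x"] v_one by simp

lemma v_power: "v (\<pi> ^ n) = int n"
  by (induction n) (simp_all add: v_one v_mult \<pi>_nonzero v_\<pi>)

lemma v_powi: "v (\<pi> powi a) = a"
  by (simp add: power_int_def v_power v_inverse \<pi>_nonzero power_inverse)

lemma val_ge_powi: "val_ge v a (\<pi> powi a)"
  by (simp add: val_ge_def v_powi)

lemma carrier_G: "X \<in> carrier G \<Longrightarrow> X \<in> carrier_mat (2 * k) (2 * k)"
  by (simp add: mem_GL_iff)

lemma inverse_in_G:
  assumes "X \<in> carrier_mat (2 * k) (2 * k)" "Y \<in> carrier_mat (2 * k) (2 * k)" "X * Y = 1\<^sub>m (2 * k)"
  shows "X \<in> carrier G" "inv\<^bsub>G\<^esub> X = Y"
proof -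
  have *: "Y * X = 1\<^sub>m (2 * k)" by (rule mat_mult_left_right_inverse) (use assms in auto)
  then show X: "X \<in> carrier G" using assms by (auto simp: mem_GL_iff)
  have "Y \<in> carrier G" using assms * by (auto simp: mem_GL_iff)
  then show "inv\<^bsub>G\<^esub> X = Y" using G.inv_equality[OF * X] by simp
qed

text \<open>This form is symmetric in \<open>X\<close> and its inverse, so that closure under
  inverses is immediate.\<close>

lemma mem_P_iff: "X \<in> P \<longleftrightarrow> X \<in> carrier G \<and> block_ge v k 0 0 1 0 X \<and> block_ge v k 0 0 1 0 (inv\<^bsub>G\<^esub> X)"
proof
  assume X: "X \<in> P"
  then have Xc: "X \<in> carrier G" by (simp add: parahoric_def)
  then have iXc: "inv\<^bsub>G\<^esub> X \<in> carrier_mat (2 * k) (2 * k)" using carrier_G by simp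
  have 1: "block_ge v k 0 0 1 0 X"
    unfolding block_ge_def using X carrier_G[OF Xc] by (auto simp: parahoric_def valuation_ring_def)
  moreover have 2: "block_ge v k 0 0 0 0 (inv\<^bsub>G\<^esub> X)"
    unfolding block_ge_def using X iXc by (auto simp: parahoric_def valuation_ring_def)
  ultimately show "X \<in> carrier G \<and> block_ge v k 0 0 1 0 X \<and> block_ge v k 0 0 1 0 (inv\<^bsub>G\<^esub> X)"
    using lower_left_block_inverse[OF 1 2] Xc by simp
next
  assume X: "X \<in> carrier G \<and> block_ge v k 0 0 1 0 X \<and> block_ge v k 0 0 1 0 (inv\<^bsub>G\<^esub> X)"
  have "val_ge v 0 (Y $$ (i, j))" if "block_ge v k 0 0 1 0 Y" "i < 2 * k" "j < 2 * k" for Y i j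
    by (rule val_ge_mono[OF block_geD[OF that]]) auto
  moreover have "val_ge v 1 (X $$ (i, j))" if "i \<in> {k..<2 * k}" "j < k" for i j
    using block_geD[of v k 0 0 1 0 X i j] X that by simp
  ultimately show "X \<in> P"
    unfolding parahoric_def valuation_ring_def using X by auto
qed

lemma mem_PI:
  assumes "block_ge v k 0 0 1 0 X" "block_ge v k 0 0 1 0 Y" "X * Y = 1\<^sub>m (2 * k)"
  shows "X \<in> P" "inv\<^bsub>G\<^esub> X = Y"
  using assms inverse_in_G[OF block_ge_carrier[OF assms(1)] block_ge_carrier[OF assms(2)] assms(3)]
  by (auto simp: mem_P_iff)

lemma P_D:
  assumes "X \<in> P"
  shows "X \<in> carrier G" "block_ge v k 0 0 1 0 X" "block_ge v k 0 0 1 0 (inv\<^bsub>G\<^esub> X)"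
  using assms by (auto simp: mem_P_iff)

lemma subgroup_P: "subgroup P G"
proof (rule G.subgroupI)
  have "block_ge v k 0 0 1 0 (four_block_mat (1\<^sub>m k) (0\<^sub>m k k) (0\<^sub>m k k) (1\<^sub>m k :: 'a mat))"
    by (subst block_ge_four_block_mat) (simp_all add: entries_ge_one entries_ge_zero)
  then have "block_ge v k 0 0 1 0 (1\<^sub>m (2 * k))"
    by (simp add: mult_2)
  then show "P \<noteq> {}" using mem_PI[of "1\<^sub>m (2 * k)" "1\<^sub>m (2 * k)"] by auto
  show "X * Y \<in> P" if XY: "X \<in> P" "Y \<in> P" for X Y
  proof -
    note X = P_D[OF XY(1)] and Y = P_D[OF XY(2)]
    have "block_ge v k 0 0 1 0 (X * Y)" using block_ge_mult[OF X(2) Y(2)] by simp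
    moreover have "block_ge v k 0 0 1 0 (inv\<^bsub>G\<^esub> (X * Y))"
      using block_ge_mult[OF Y(3) X(3)] X(1) Y(1) by (simp add: G.inv_mult_group)
    ultimately show ?thesis using X(1) Y(1) by (simp add: mem_P_iff)
  qed
qed (auto simp: mem_P_iff)

section \<open>The diagonal elements and \<open>t\<close>\<close>

lemma D_carrier_mat: "D a b \<in> carrier_mat (2 * k) (2 * k)"
  by (simp add: block_diag_def mult_2)

lemma D_mult: "D a b * D c d = D (a + c) (b + d)"
  unfolding block_diag_def
  by (subst mult_four_block_mat[of _ k k _ k _ k _ _ k _ k]) (simp_all add: power_int_add \<pi>_nonzero)

lemma D_zero: "D 0 0 = 1\<^sub>m (2 * k)"
  by (simp add: block_diag_def mult_2)

lemma D_carrier: "D a b \<in> carrier G" and inv_D: "inv\<^bsub>G\<^esub> D a b = D (- a) (- b)"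
  using inverse_in_G[of "D a b" "D (- a) (- b)"] by (simp_all add: D_mult D_zero D_carrier_mat)

lemma t_square: "t * t = D 1 1"
  unfolding block_diag_def t_mat_def
  by (subst mult_four_block_mat[of _ k k _ k _ k _ _ k _ k]) simp_all

lemma t_D: "t * D a b = D b a * t"
proof -
  have 1: "1\<^sub>m k * (x \<cdot>\<^sub>m 1\<^sub>m k) = x \<cdot>\<^sub>m (1\<^sub>m k :: 'a mat)" "(x \<cdot>\<^sub>m 1\<^sub>m k) * 1\<^sub>m k = x \<cdot>\<^sub>m (1\<^sub>m k :: 'a mat)" for x
    by simp_all
  show ?thesis
    unfolding block_diag_def t_mat_def
    by (subst (1 2) mult_four_block_mat[of _ k k _ k _ k _ _ k _ k]) (simp_all add: 1 mult.commute)
qed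

lemma t_carrier_mat: "t \<in> carrier_mat (2 * k) (2 * k)"
  by (simp add: t_mat_def mult_2)

lemma t_carrier: "t \<in> carrier G" and inv_t: "inv\<^bsub>G\<^esub> t = D (- 1) (- 1) * t"
proof -
  have "t * (D (- 1) (- 1) * t) = (t * D (- 1) (- 1)) * t"
    by (rule assoc_mult_mat[symmetric]) (rule t_carrier_mat D_carrier_mat)+
  also have "\<dots> = D (- 1) (- 1) * (t * t)"
    unfolding t_D by (rule assoc_mult_mat) (rule t_carrier_mat D_carrier_mat)+
  also have "\<dots> = 1\<^sub>m (2 * k)" by (simp add: t_square D_mult D_zero)
  finally have "t * (D (- 1) (- 1) * t) = 1\<^sub>m (2 * k)" .
  from inverse_in_G[OF t_carrier_mat _ this]
  show "t \<in> carrier G" "inv\<^bsub>G\<^esub> t = D (- 1) (- 1) * t"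
    using mult_carrier_mat[OF D_carrier_mat t_carrier_mat] by simp_all
qed

lemma w_eq: "w_mat k = D 0 (- 1) * t"
  unfolding block_diag_def t_mat_def w_mat_def
  by (subst mult_four_block_mat[of _ k k _ k _ k _ _ k _ k]) (simp_all add: \<pi>_nonzero power_int_minus)

text \<open>Since the off-diagonal blocks are zero, \<open>m\<close> and \<open>n\<close> are free
  and can be chosen large in later products; in \<open>block_ge_t\<close> the same holds for the
  diagonal blocks.\<close>

lemma block_ge_D: "block_ge v k a m n b (D a b)"
  unfolding block_diag_def
  by (subst block_ge_four_block_mat) (simp_all add: entries_ge_zero entries_ge_smult val_ge_powi)

lemma block_ge_t: "block_ge v k m 0 1 n t"
proof -
  have "val_ge v 1 \<pi>" using v_\<pi> by (simp add: val_ge_def)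
  then show ?thesis
    unfolding t_mat_def
    by (subst block_ge_four_block_mat) (simp_all add: entries_ge_zero entries_ge_smult entries_ge_one)
qed

lemma block_ge_D_mult:
  assumes "block_ge v k a b c d X"
  shows "block_ge v k (x + a) (x + b) (y + c) (y + d) (D x y * X)"
  \<comment> \<open>The two maxima are the least bounds for the zero blocks under which their
    products with \<open>X\<close> satisfy the bounds claimed.\<close>
  by (rule block_ge_mult[OF block_ge_D[of x "max (x + a - c) (x + b - d)" "max (y + c - a) (y + d - b)" y] assms])
    auto

lemma block_ge_mult_D:
  assumes "block_ge v k a b c d X"
  shows "block_ge v k (a + x) (b + y) (c + x) (d + y) (X * D x y)"
  by (rule block_ge_mult[OF assms block_ge_D[of x "max (b + y - a) (d + y - c)" "max (a + x - b) (c + x - d)" y]])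
    auto

text \<open>Conjugation by \<open>D x y\<close> fixes the diagonal blocks and multiplies the upper
  right block by \<open>\<pi> powi (x - y)\<close>, the lower left one by
  \<open>\<pi> powi (y - x)\<close>.\<close>

lemma block_ge_conj_D:
  assumes "block_ge v k a b c d X"
  shows "block_ge v k a (b + (x - y)) (c + (y - x)) d (D x y * X * D (- x) (- y))"
  using block_ge_mult_D[OF block_ge_D_mult[OF assms, of x y], of "- x" "- y"]
  by (simp add: algebra_simps)

text \<open>Conjugation by \<open>t\<close> swaps the diagonal blocks, moves the upper right block
  to the lower left multiplied by \<pi>, and moves the lower left block to the upper right divided
  by \<pi>. This preserves the bounds defining \<open>P\<close>.\<close>

lemma t_normalizing: "t \<in> normalizing G P"
proof -
  have it: "block_ge v k m (- 1) 0 n (inv\<^bsub>G\<^esub> t)" for m n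
    unfolding inv_t
    using block_ge_D_mult[OF block_ge_t[of "m + 1" "n + 1"], of "- 1" "- 1"] by simp
  have 1: "block_ge v k 0 0 1 0 (t * X * inv\<^bsub>G\<^esub> t)" if "block_ge v k 0 0 1 0 X" for X
  proof -
    \<comment> \<open>The diagonal blocks of \<open>t\<close> are zero, so any bound may be claimed
      for them; 5 is large enough.\<close>
    have "block_ge v k 1 0 1 1 (t * X)" by (rule block_ge_mult[OF block_ge_t[of 5 5] that]) auto
    from block_ge_mult[OF this it[of 5 5]] show ?thesis by simp
  qed
  have 2: "block_ge v k 0 0 1 0 (inv\<^bsub>G\<^esub> t * X * t)" if "block_ge v k 0 0 1 0 X" for X
  proof -
    have "block_ge v k 0 (- 1) 0 0 (inv\<^bsub>G\<^esub> t * X)" by (rule block_ge_mult[OF it[of 5 5] that]) auto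
    from block_ge_mult[OF this block_ge_t[of 5 5]] show ?thesis by simp
  qed
  have "t * X * inv\<^bsub>G\<^esub> t \<in> P \<and> inv\<^bsub>G\<^esub> t * X * t \<in> P" if X: "X \<in> P" for X
  proof -
    note X' = P_D[OF X]
    have "inv\<^bsub>G\<^esub> (t * X * inv\<^bsub>G\<^esub> t) = t * inv\<^bsub>G\<^esub> X * inv\<^bsub>G\<^esub> t"
      "inv\<^bsub>G\<^esub> (inv\<^bsub>G\<^esub> t * X * t) = inv\<^bsub>G\<^esub> t * inv\<^bsub>G\<^esub> X * t"
      using X'(1) t_carrier by (simp_all add: G.inv_mult_group G.m_assoc)
    then show ?thesis
      unfolding mem_P_iff using 1 2 X' t_carrier by simp
  qed
  then show ?thesis using t_carrier by (simp add: normalizing_def)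
qed

end

section \<open>Factorization of the parahoric subgroup\<close>

definition lower_unipotent :: "nat \<Rightarrow> 'a::field mat \<Rightarrow> 'a mat" where
  "lower_unipotent k Z = four_block_mat (1\<^sub>m k) (0\<^sub>m k k) Z (1\<^sub>m k)"

lemma lower_unipotent_mult:
  assumes "Z \<in> carrier_mat k k" "Z' \<in> carrier_mat k k"
  shows "lower_unipotent k Z * lower_unipotent k Z' = lower_unipotent k (Z + Z')"
  unfolding lower_unipotent_def
  using assms by (subst mult_four_block_mat[of _ k k _ k _ k _ _ k _ k]) simp_all

lemma lower_unipotent_zero: "lower_unipotent k (0\<^sub>m k k) = 1\<^sub>m (2 * k)"
  by (simp add: lower_unipotent_def mult_2)

lemma add_uminus_mat_self:
  fixes A :: "'a::ring_1 mat"
  shows "A \<in> carrier_mat n m \<Longrightarrow> A + - A = 0\<^sub>m n m"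
  by (rule eq_matI) auto

context parahoric_setting
begin

abbreviation "L Z \<equiv> lower_unipotent k Z :: 'a mat"

lemma block_ge_L:
  assumes "Z \<in> carrier_mat k k" "entries_ge v m Z"
  shows "block_ge v k 0 n m 0 (L Z)"
  unfolding lower_unipotent_def using assms
  by (subst block_ge_four_block_mat) (simp_all add: entries_ge_one entries_ge_zero)

lemma L_inverse:
  assumes "Z \<in> carrier_mat k k"
  shows "L Z \<in> carrier G" "inv\<^bsub>G\<^esub> L Z = L (- Z)"
proof -
  have "L Z * L (- Z) = 1\<^sub>m (2 * k)"
    using assms by (simp add: lower_unipotent_mult lower_unipotent_zero add_uminus_mat_self)
  from inverse_in_G[OF _ _ this] show "L Z \<in> carrier G" "inv\<^bsub>G\<^esub> L Z = L (- Z)"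
    using assms by (simp_all add: lower_unipotent_def mult_2)
qed

text \<open>Block Gauss elimination: \<open>A\<close> is invertible over the valuation ring, and Z =
  C A^-1 clears the lower left block. The bounds for every \<open>n\<close> express that this block
  vanishes in \<open>b\<close> and in its inverse.\<close>

lemma lower_upper_factorization:
  assumes p: "p \<in> P"
  obtains Z b where "Z \<in> carrier_mat k k" "entries_ge v 1 Z" "b \<in> P" "p = L Z * b"
    "\<And>n. block_ge v k 0 0 n 0 b" "\<And>n. block_ge v k 0 0 n 0 (inv\<^bsub>G\<^esub> b)"
proof -
  note P = P_D[OF p]
  obtain A B C E where X: "A \<in> carrier_mat k k" "B \<in> carrier_mat k k" "C \<in> carrier_mat k k"
    "E \<in> carrier_mat k k" "p = four_block_mat A B C E"
    "entries_ge v 0 A" "entries_ge v 0 B" "entries_ge v 1 C" "entries_ge v 0 E"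
    using P(2) by (rule block_geE)
  obtain A' B' C' E' where Y: "A' \<in> carrier_mat k k" "B' \<in> carrier_mat k k" "C' \<in> carrier_mat k k"
    "E' \<in> carrier_mat k k" "inv\<^bsub>G\<^esub> p = four_block_mat A' B' C' E'"
    "entries_ge v 0 A'" "entries_ge v 0 B'" "entries_ge v 1 C'" "entries_ge v 0 E'"
    using P(3) by (rule block_geE)
  have "block_ge v k 0 0 0 0 (inv\<^bsub>G\<^esub> p)" using block_ge_mono[OF P(3)] by simp
  from upper_left_block_invertible[OF X(1-4) P(2)[unfolded X(5)] this]
  obtain R where R: "R \<in> carrier_mat k k" "A * R = 1\<^sub>m k" "R * A = 1\<^sub>m k" "entries_ge v 0 R"
    using P(1) unfolding X(5) by auto
  define Z where "Z = C * R"
  have Z: "Z \<in> carrier_mat k k" "entries_ge v 1 Z"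
    unfolding Z_def using entries_ge_mult[OF X(3) R(1) X(8) R(4)] X(3) R(1) by auto
  have nZ: "- Z \<in> carrier_mat k k" "entries_ge v 1 (- Z)"
    using Z entries_ge_uminus by auto
  have LP: "L Z \<in> P" "L (- Z) \<in> P"
    unfolding mem_P_iff
    using L_inverse[OF Z(1)] L_inverse[OF nZ(1)] block_ge_L[OF Z] block_ge_L[OF nZ]
    by (auto simp: uminus_uminus_mat)
  define b where "b = L (- Z) * p"
  have bP: "b \<in> P" unfolding b_def using subgroup.m_closed[OF subgroup_P LP(2) p] by simp
  have pb: "p = L Z * b"
    unfolding b_def using G.inv_cancel(2)[OF L_inverse(1)[OF Z(1)] P(1)] L_inverse(2)[OF Z(1)] by simp
  have ZA: "Z * A = C"
    unfolding Z_def using assoc_mult_mat[OF X(3) R(1) X(1)] R(3) X(3) by simp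
  have "- Z * A + C = 0\<^sub>m k k"
    using Z(1) X(1,3) ZA by (simp add: uminus_l_inv_mat)
  moreover have "b = four_block_mat (1\<^sub>m k * A + 0\<^sub>m k k * C) (1\<^sub>m k * B + 0\<^sub>m k k * E)
      (- Z * A + 1\<^sub>m k * C) (- Z * B + 1\<^sub>m k * E)"
    unfolding b_def lower_unipotent_def X(5)
    using nZ(1) X(1-4) by (intro mult_four_block_mat) auto
  ultimately have b_eq: "b = four_block_mat A B (0\<^sub>m k k) (- Z * B + E)"
    using X(1-4) by simp
  have "block_ge v k 0 0 1 0 b" using P_D(2)[OF bP] .
  then have 1: "block_ge v k 0 0 n 0 b" for n
    unfolding b_eq using X(1-4) Z(1) by (simp add: block_ge_four_block_mat entries_ge_zero)
  \<comment> \<open>The relation C' A + E' C = 0 from p^-1 p = 1, multiplied by \<open>R\<close>,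
    says that the lower left block C' + E' Z of b^-1 = p^-1 \<open>L Z\<close> is zero.\<close>
  have "four_block_mat (A' * A + B' * C) (A' * B + B' * E) (C' * A + E' * C) (C' * B + E' * E)
      = four_block_mat (1\<^sub>m k) (0\<^sub>m k k) (0\<^sub>m k k) (1\<^sub>m k)"
    using G.l_inv[OF P(1)] unfolding Y(5) unfolding X(5) mult_four_block_mat[OF Y(1-4) X(1-4)]
    by (simp only: four_block_one_mat mult_2)
  then have 0: "C' * A + E' * C = 0\<^sub>m k k"
    by (rule four_block_mat_inject(3)[rotated 8]) (use X(1-4) Y(1-4) in auto)
  have "C' + E' * Z = C' * (A * R) + E' * (C * R)" unfolding R(2) Z_def using Y(3) by simp
  also have "\<dots> = C' * A * R + E' * C * R"
    using assoc_mult_mat[OF Y(3) X(1) R(1)] assoc_mult_mat[OF Y(4) X(3) R(1)] by simp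
  also have "\<dots> = (C' * A + E' * C) * R"
    using X(1,3) Y(3,4) R(1) by (intro add_mult_distrib_mat[symmetric]) auto
  also have "\<dots> = 0\<^sub>m k k" unfolding 0 using R(1) by simp
  finally have C'0: "C' + E' * Z = 0\<^sub>m k k" .
  have "inv\<^bsub>G\<^esub> b = inv\<^bsub>G\<^esub> p * L Z"
    unfolding b_def using P(1) L_inverse[OF nZ(1)] by (simp add: G.inv_mult_group uminus_uminus_mat)
  also have "\<dots> = four_block_mat (A' * 1\<^sub>m k + B' * Z) (A' * 0\<^sub>m k k + B' * 1\<^sub>m k)
      (C' * 1\<^sub>m k + E' * Z) (C' * 0\<^sub>m k k + E' * 1\<^sub>m k)"
    unfolding Y(5) lower_unipotent_def
    using Z(1) Y(1-4) by (intro mult_four_block_mat) auto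
  also have "\<dots> = four_block_mat (A' + B' * Z) B' (0\<^sub>m k k) E'"
    using Y(1-4) C'0 by simp
  finally have ib_eq: "inv\<^bsub>G\<^esub> b = four_block_mat (A' + B' * Z) B' (0\<^sub>m k k) E'" .
  have "block_ge v k 0 0 1 0 (inv\<^bsub>G\<^esub> b)" using P_D(3)[OF bP] .
  then have 2: "block_ge v k 0 0 n 0 (inv\<^bsub>G\<^esub> b)" for n
    unfolding ib_eq using Y(1-4) Z(1) by (simp add: block_ge_four_block_mat entries_ge_zero)
  show ?thesis by (rule that[OF Z bP pb 1 2])
qed

lemma conj_D_mem_P:
  assumes X: "X \<in> carrier G"
    and "block_ge v k 0 b c 0 X" "block_ge v k 0 b c 0 (inv\<^bsub>G\<^esub> X)" "0 \<le> b + (x - y)" "1 \<le> c + (y - x)"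
  shows "D x y * X * D (- x) (- y) \<in> P"
proof -
  have "inv\<^bsub>G\<^esub> (D x y * X * D (- x) (- y)) = D x y * inv\<^bsub>G\<^esub> X * D (- x) (- y)"
    using X D_carrier by (simp add: G.inv_mult_group G.m_assoc inv_D)
  moreover have "block_ge v k 0 0 1 0 (D x y * Y * D (- x) (- y))" if "block_ge v k 0 b c 0 Y" for Y
    using block_ge_mono[OF block_ge_conj_D[OF that, of x y], of 0 0 1 0] assms by simp
  ultimately show ?thesis
    using X D_carrier assms by (simp add: mem_P_iff)
qed

lemma conj_D_L:
  assumes "Z \<in> carrier_mat k k" "entries_ge v m Z" "1 \<le> m + (y - x)"
  shows "D x y * L Z * D (- x) (- y) \<in> P"
proof (rule conj_D_mem_P)
  show "L Z \<in> carrier G" using L_inverse assms by simp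
  \<comment> \<open>The upper right block of \<open>L Z\<close> is zero; \<open>y - x\<close> is the
    bound that compensates for the conjugation there.\<close>
  show "block_ge v k 0 (y - x) m 0 (L Z)" using block_ge_L assms by simp
  show "block_ge v k 0 (y - x) m 0 (inv\<^bsub>G\<^esub> L Z)"
    using block_ge_L[of "- Z"] assms L_inverse entries_ge_uminus by simp
qed (use assms in auto)

lemma conj_D_upper:
  assumes "b \<in> P" "\<And>n. block_ge v k 0 0 n 0 b" "\<And>n. block_ge v k 0 0 n 0 (inv\<^bsub>G\<^esub> b)" "x \<le> y"
  shows "D (- x) (- y) * b * D x y \<in> P"
  \<comment> \<open>Conjugation lowers the bound for the vanishing lower left block by
    \<open>y - x\<close>, so starting from \<open>1 + y - x\<close> leaves the 1 that
    \<open>P\<close> demands.\<close>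
  using conj_D_mem_P[of b 0 "1 + y - x" "- x" "- y"] assms P_D by simp

lemma factors_through_D:
  assumes "a \<le> b" "c \<le> d"
  shows "factors_through G P (D a b) (D c d)"
  unfolding factors_through_def GL_simps
proof
  fix p assume p: "p \<in> P"
  obtain Z q where q: "Z \<in> carrier_mat k k" "entries_ge v 1 Z" "q \<in> P" "p = L Z * q"
    "\<And>n. block_ge v k 0 0 n 0 q" "\<And>n. block_ge v k 0 0 n 0 (inv\<^bsub>G\<^esub> q)"
    using lower_upper_factorization[OF p] by blast
  \<comment> \<open>This is the conjugation by \<open>D 0 0\<close>, which is the identity.\<close>
  have "L Z \<in> P" using conj_D_L[of Z 1 0 0] q D_zero L_inverse(1) by simp
  moreover have "D a b * L Z * inv\<^bsub>G\<^esub> D a b \<in> P"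
    using conj_D_L[of Z 1 b a] q assms by (simp add: inv_D)
  moreover have "inv\<^bsub>G\<^esub> D c d * q * D c d \<in> P"
    using conj_D_upper[OF q(3,5,6) assms(2)] by (simp add: inv_D)
  ultimately show "\<exists>x\<in>P. \<exists>y\<in>P. p = x * y \<and> D a b * x * inv\<^bsub>G\<^esub> D a b \<in> P \<and> inv\<^bsub>G\<^esub> D c d * y * D c d \<in> P"
    using q(3,4) by blast
qed

text \<open>The left-hand side can have poles only in the lower left block, while the right-hand
  side satisfies the lower left condition of \<open>P\<close>. Merging these bounds, for the element
  and for its inverse, gives membership in \<open>P\<close>.\<close>

lemma meets_trivially_D:
  assumes "a \<le> b" "c \<le> d"
  shows "meets_trivially G P (D a b) (D c d)"
  unfolding meets_trivially_def GL_simps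
proof (intro ballI impI)
  fix p q r assume p: "p \<in> P" and q: "q \<in> P" and r: "r \<in> P"
  let ?X = "inv\<^bsub>G\<^esub> D a b * p * D a b" and ?Y = "D c d * q * inv\<^bsub>G\<^esub> D c d"
  assume eq: "?X = ?Y * r"
  note p' = P_D[OF p] and q' = P_D[OF q] and r' = P_D[OF r]
  have c: "?X \<in> carrier G" "?Y \<in> carrier G" using p' q' D_carrier by simp_all
  have iX: "inv\<^bsub>G\<^esub> ?X = inv\<^bsub>G\<^esub> D a b * inv\<^bsub>G\<^esub> p * D a b"
    and iY: "inv\<^bsub>G\<^esub> ?Y = D c d * inv\<^bsub>G\<^esub> q * inv\<^bsub>G\<^esub> D c d"
    using p' q' D_carrier by (simp_all add: G.inv_mult_group G.m_assoc)
  have X: "block_ge v k 0 0 (1 - (b - a)) 0 (inv\<^bsub>G\<^esub> D a b * x * D a b)" if "block_ge v k 0 0 1 0 x" for x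
    using block_ge_mono[OF block_ge_conj_D[OF that, of "- a" "- b"], of 0 0 "1 - (b - a)" 0] assms
    by (simp add: inv_D)
  have Y: "block_ge v k 0 (- (d - c)) 1 0 (D c d * y * inv\<^bsub>G\<^esub> D c d)" if "block_ge v k 0 0 1 0 y" for y
    using block_ge_mono[OF block_ge_conj_D[OF that, of c d], of 0 "- (d - c)" 1 0] assms
    by (simp add: inv_D)
  have "block_ge v k (- (d - c)) (- (d - c)) 1 0 ?X"
    unfolding eq by (rule block_ge_mult[OF Y[OF q'(2)] r'(2)]) (use assms in auto)
  then have 1: "block_ge v k 0 0 1 0 ?X"
    using block_ge_combine[OF X[OF p'(2)]] by blast
  have "inv\<^bsub>G\<^esub> ?X = inv\<^bsub>G\<^esub> r * inv\<^bsub>G\<^esub> ?Y"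
    unfolding eq using c r'(1) by (simp add: G.inv_mult_group)
  \<comment> \<open>In the inverse the factor from \<open>r\<close> stands on the left, so poles
    spread over the right column instead of the upper row; the lower left bound survives.\<close>
  moreover have "block_ge v k 0 (- (d - c)) 1 (- (d - c)) (inv\<^bsub>G\<^esub> r * inv\<^bsub>G\<^esub> ?Y)"
    unfolding iY by (rule block_ge_mult[OF r'(3) Y[OF q'(3)]]) (use assms in auto)
  ultimately have "block_ge v k 0 (- (d - c)) 1 (- (d - c)) (inv\<^bsub>G\<^esub> ?X)" by simp
  then have "block_ge v k 0 0 1 0 (inv\<^bsub>G\<^esub> ?X)"
    using block_ge_combine[OF X[OF p'(3), folded iX]] by blast
  with 1 c show "?X \<in> P" by (simp add: mem_P_iff)
qed

section \<open>Finitely many left cosets in the double coset of a diagonal element\<close>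

text \<open>Truncated \<pi>-adic expansions with digits in a finite set of residue representatives
  suffice; the induction adds one digit.\<close>

lemma finite_residues:
  "\<exists>S. finite S \<and> (\<forall>x. val_ge v 0 x \<longrightarrow> (\<exists>s\<in>S. val_ge v (int m) (x - s)))"
proof -
  define S1 where "S1 = (\<lambda>C. SOME x. x \<in> C) ` (valuation_ring v // residue_rel v)"
  have fin: "finite S1" unfolding S1_def using finite_residue_field by simp
  have S1: "\<exists>s\<in>S1. val_ge v 1 (x - s)" if "val_ge v 0 x" for x
  proof -
    let ?C = "residue_rel v `` {x}"
    have "x \<in> ?C" using that by (simp add: residue_rel_def valuation_ring_def)
    then have "(SOME y. y \<in> ?C) \<in> ?C" by (rule someI)
    then have "val_ge v 1 (x - (SOME y. y \<in> ?C))" by (auto simp: residue_rel_def)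
    moreover have "?C \<in> valuation_ring v // residue_rel v"
      using that by (auto simp: quotient_def valuation_ring_def)
    ultimately show ?thesis unfolding S1_def by blast
  qed
  show ?thesis
  proof (induction m)
    case 0
    show ?case by (rule exI[of _ "{0}"]) simp
  next
    case (Suc m)
    then obtain S where S: "finite S" "\<And>x. val_ge v 0 x \<Longrightarrow> \<exists>s\<in>S. val_ge v (int m) (x - s)" by blast
    let ?S = "(\<lambda>(s, s'). s + \<pi> ^ m * s') ` (S \<times> S1)"
    have "\<exists>s\<in>?S. val_ge v (int (Suc m)) (x - s)" if x: "val_ge v 0 x" for x
    proof -
      obtain s where s: "s \<in> S" "val_ge v (int m) (x - s)" using S(2)[OF x] by blast
      \<comment> \<open>Dividing the remainder by \<open>\<pi> ^ m\<close> makes it integral, and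
        its residue supplies the next digit.\<close>
      have "val_ge v (- int m) (inverse (\<pi> ^ m))"
        by (simp add: val_ge_def v_inverse v_power \<pi>_nonzero)
      from val_ge_mult[OF this s(2)] obtain s' where
        s': "s' \<in> S1" "val_ge v 1 (inverse (\<pi> ^ m) * (x - s) - s')" using S1 by auto
      have "val_ge v (int m) (\<pi> ^ m)" by (simp add: val_ge_def v_power)
      from val_ge_mult[OF this s'(2)]
      have "val_ge v (int (Suc m)) (x - (s + \<pi> ^ m * s'))"
        by (simp add: algebra_simps \<pi>_nonzero)
      with s s' show ?thesis by (intro bexI[of _ "s + \<pi> ^ m * s'"]) auto
    qed
    moreover have "finite ?S" using S fin by simp
    ultimately show ?case by blast
  qed
qed

text \<open>In p = \<open>L Z * q\<close> the upper triangular \<open>q\<close> passes through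
  \<open>D a b\<close> into \<open>P\<close>. So does the lower unipotent part divisible by a high
  power of \<pi>, hence only the finitely many residues of \<open>Z\<close> remain.\<close>

lemma finite_coset_reps_D:
  assumes ab: "a \<le> b"
  obtains F where "finite F" "F \<subseteq> carrier G" "\<And>p. p \<in> P \<Longrightarrow> \<exists>x\<in>F. \<exists>q\<in>P. p * D a b = x * D a b * q"
proof -
  \<comment> \<open>Moving a lower unipotent matrix to the right of \<open>D a b\<close> costs
    \<open>b - a\<close> in valuation; one more is needed for the lower left condition of
    \<open>P\<close>.\<close>
  define m where "m = nat (b - a) + 1"
  obtain S where S: "finite S" "\<And>x. val_ge v 0 x \<Longrightarrow> \<exists>s\<in>S. val_ge v (int m) (x - s)"
    using finite_residues[of m] by blast
  define F where "F = (\<lambda>f. L (mat k k f)) ` (({..<k} \<times> {..<k}) \<rightarrow>\<^sub>E S)"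
  have "finite F" unfolding F_def using S(1) by (intro finite_imageI finite_PiE) auto
  moreover have "F \<subseteq> carrier G" unfolding F_def using L_inverse(1) by auto
  moreover have "\<exists>x\<in>F. \<exists>q\<in>P. p * D a b = x * D a b * q" if p: "p \<in> P" for p
  proof -
    obtain Z q where q: "Z \<in> carrier_mat k k" "entries_ge v 1 Z" "q \<in> P" "p = L Z * q"
      "\<And>n. block_ge v k 0 0 n 0 q" "\<And>n. block_ge v k 0 0 n 0 (inv\<^bsub>G\<^esub> q)"
      using lower_upper_factorization[OF p] by blast
    have "val_ge v 0 (Z $$ (i, j))" if "i < k" "j < k" for i j
      using q(1,2) that val_ge_mono[of 1 "Z $$ (i, j)" 0] by (auto simp: entries_ge_def)
    then have "\<forall>ij\<in>{..<k} \<times> {..<k}. \<exists>s\<in>S. val_ge v (int m) (Z $$ ij - s)" using S(2) by auto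
    then obtain g where g: "\<And>ij. ij \<in> {..<k} \<times> {..<k} \<Longrightarrow> g ij \<in> S \<and> val_ge v (int m) (Z $$ ij - g ij)"
      by metis
    define f where "f = restrict g ({..<k} \<times> {..<k})"
    define Y where "Y = mat k k f"
    have f: "f \<in> ({..<k} \<times> {..<k}) \<rightarrow>\<^sub>E S" using g by (auto simp: f_def)
    have Y: "Y \<in> carrier_mat k k" by (simp add: Y_def)
    have LY: "L Y \<in> F" unfolding F_def Y_def using f by blast
    have ZY: "Z - Y \<in> carrier_mat k k" using Y q(1) by auto
    have "entries_ge v (int m) (Z - Y)"
      using g q(1) by (auto simp: entries_ge_def Y_def f_def)
    then have R: "D (- a) (- b) * L (Z - Y) * D a b \<in> P"
      using conj_D_L[OF ZY, of "int m" "- b" "- a"] ab by (simp add: m_def)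
    have T: "D (- a) (- b) * q * D a b \<in> P" by (rule conj_D_upper[OF q(3,5,6) ab])
    have "Y + (Z - Y) = Z" using q(1) Y by (intro eq_matI) auto
    then have LL: "L Z = L Y * L (Z - Y)" using lower_unipotent_mult[OF Y ZY] by simp
    have "p * D a b = L Y * D a b * ((D (- a) (- b) * L (Z - Y) * D a b) * (D (- a) (- b) * q * D a b))"
      unfolding q(4) LL using L_inverse(1)[OF Y] L_inverse(1)[OF ZY] P_D(1)[OF q(3)]
      by (simp add: G.m_assoc D_carrier G.inv_cancel flip: inv_D)
    with LY subgroup.m_closed[OF subgroup_P R T] show ?thesis by auto
  qed
  ultimately show ?thesis using that by blast
qed

text \<open>The factors from the normalizer will be powers of \<open>t\<close>: the outer ones come
  from the normal forms, and \<open>m\<close> allows the diagonal entries to be swapped into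
  increasing order.\<close>

lemma hecke_conv_D:
  assumes "a \<le> b" "c \<le> d" and n: "l \<in> normalizing G P" "m \<in> normalizing G P" "n \<in> normalizing G P"
  shows "hecke_conv G P (hecke_char G P (l * D a b * m)) (hecke_char G P (inv\<^bsub>G\<^esub> m * D c d * n))
    = hecke_char G P (l * D a b * m * (inv\<^bsub>G\<^esub> m * D c d * n))"
proof -
  note P = subgroup_P
  have nc: "l \<in> carrier G" "m \<in> carrier G" "n \<in> carrier G"
    using n by (auto simp: normalizing_def)
  obtain F where "finite F" "F \<subseteq> carrier G"
    "\<And>p. p \<in> P \<Longrightarrow> \<exists>x\<in>F. \<exists>q\<in>P. p * D a b = x * D a b * q"
    using finite_coset_reps_D[OF assms(1)] by blast
  then have "finite {C \<in> lcosets\<^bsub>G\<^esub> P. C \<inter> double_coset G P (l * D a b * m) \<noteq> {}}"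
    using G.finite_double_coset_normalizing[OF P D_carrier n(1,2)] by blast
  then show ?thesis
    using nc D_carrier
    by (intro G.hecke_conv_double_coset[OF P]
       G.factors_through_normalizing[OF P] G.meets_trivially_normalizing[OF P]
       n factors_through_D meets_trivially_D assms) auto
qed

end

section \<open>Length and multiplication\<close>

context parahoric_setting
begin

section \<open>Powers of \<open>t\<close> and their relations with diagonal elements\<close>

abbreviation tpow :: "int \<Rightarrow> 'a mat" where "tpow e \<equiv> t [^]\<^bsub>G\<^esub> e"

lemma tpow_carrier: "tpow e \<in> carrier G"
  using t_carrier by simp

lemma D_nat_pow: "D 1 1 [^]\<^bsub>G\<^esub> (n::nat) = D (int n) (int n)"
  by (induction n) (simp_all add: nat_pow_def D_zero D_mult algebra_simps)

lemma tpow_even: "tpow (2 * i) = D i i"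
proof -
  have "tpow (2 * i) = (tpow 2) [^]\<^bsub>G\<^esub> i" using G.int_pow_pow[OF t_carrier] by simp
  also have "tpow 2 = D 1 1"
    using G.int_pow_mult[OF t_carrier, of 1 1] t_carrier by (simp add: t_square)
  also have "D 1 1 [^]\<^bsub>G\<^esub> i = D i i"
    by (simp add: int_pow_def2 D_nat_pow inv_D)
  finally show ?thesis .
qed

lemma tpow_add: "tpow (e + f) = tpow e * tpow f"
  using G.int_pow_mult[OF t_carrier] .

lemma tpow_one: "tpow 1 = t"
  using t_carrier by simp

lemma tpow_odd: "tpow (2 * i + 1) = D i i * t"
  by (simp only: tpow_add tpow_even tpow_one)

lemma t_D_mult: "X \<in> carrier G \<Longrightarrow> t * (D a b * X) = D b a * (t * X)"
  using t_D[of a b] t_carrier D_carrier by (simp flip: G.m_assoc)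

lemma D_D_mult: "X \<in> carrier G \<Longrightarrow> D a b * (D c d * X) = D (a + c) (b + d) * X"
  using D_carrier by (simp add: D_mult flip: G.m_assoc)

text \<open>Even powers of \<open>t\<close> are the scalar matrices \<open>D i i\<close>, and odd
  powers differ from \<open>t\<close> by such a scalar.\<close>

lemma tpow_D: "tpow e * D a b = (if even e then D a b else D b a) * tpow e"
proof (cases "even e")
  case True
  then obtain i where "e = 2 * i" by blast
  then show ?thesis using True by (simp add: tpow_even D_mult add.commute)
next
  case False
  then obtain i where "e = 2 * i + 1" by (rule oddE)
  then have "tpow e = D i i * t" by (simp only: tpow_odd)
  then show ?thesis
    using False t_carrier D_carrier by (simp add: G.m_assoc t_D D_D_mult add.commute)
qed

lemma D_tpow_commute: "\<exists>c d. D a b * tpow e = tpow e * D c d"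
  using tpow_D[of e a b] tpow_D[of e b a] by metis

lemma tpow_D_commute: "\<exists>c d. tpow e * D a b = D c d * tpow e"
  using tpow_D[of e a b] by metis

lemma D_inject:
  assumes "D a b = D c d"
  shows "a = c" "b = d"
proof -
  have "\<pi> powi a \<cdot>\<^sub>m 1\<^sub>m k = \<pi> powi c \<cdot>\<^sub>m (1\<^sub>m k :: 'a mat)" "\<pi> powi b \<cdot>\<^sub>m 1\<^sub>m k = \<pi> powi d \<cdot>\<^sub>m (1\<^sub>m k :: 'a mat)"
    using assms unfolding block_diag_def
    by (auto dest: four_block_mat_inject(1,4)[rotated 8, where k = k])
  then have "(\<pi> powi a \<cdot>\<^sub>m 1\<^sub>m k) $$ (0, 0) = (\<pi> powi c \<cdot>\<^sub>m (1\<^sub>m k :: 'a mat)) $$ (0, 0)"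
    "(\<pi> powi b \<cdot>\<^sub>m 1\<^sub>m k) $$ (0, 0) = (\<pi> powi d \<cdot>\<^sub>m (1\<^sub>m k :: 'a mat)) $$ (0, 0)" by simp_all
  then have "\<pi> powi a = \<pi> powi c" "\<pi> powi b = \<pi> powi d" using k_pos by simp_all
  then show "a = c" "b = d" using v_powi by metis+
qed

lemma D_neq_t: "D a b \<noteq> t"
proof
  assume "D a b = t"
  then have "D a b $$ (0, 0) = t $$ (0, 0)" by simp
  then show False using k_pos \<pi>_nonzero by (simp add: block_diag_def t_mat_def)
qed

text \<open>Only the difference is determined, since t^2 = \<open>D 1 1\<close> allows both
  exponents to be shifted at the expense of the power of \<open>t\<close>. Cancelling makes a
  diagonal element equal to a power of \<open>t\<close>: an even power is scalar, and an odd one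
  would make \<open>t\<close> diagonal.\<close>

lemma D_tpow_eq:
  assumes eq: "D a b * tpow e = D c d * tpow f"
  shows "a - b = c - d"
proof -
  have "D (a - c) (b - d) * tpow e = D (- c) (- d) * (D a b * tpow e)"
    using tpow_carrier by (simp add: D_D_mult)
  also have "\<dots> = tpow f"
    unfolding eq using tpow_carrier carrier_G[OF tpow_carrier] by (simp add: D_D_mult D_zero)
  finally have "D (a - c) (b - d) * tpow e * tpow (- e) = tpow (f - e)"
    by (simp flip: tpow_add)
  then have D: "D (a - c) (b - d) = tpow (f - e)"
    using tpow_carrier D_carrier by (simp add: G.m_assoc flip: tpow_add)
  show ?thesis
  proof (cases "even (f - e)")
    case True
    then obtain i where "f - e = 2 * i" by blast
    then show ?thesis using D_inject[of "a - c" "b - d" i i] D tpow_even by simp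
  next
    case False
    then obtain i where "f - e = 2 * i + 1" by (rule oddE)
    then have "D (a - c) (b - d) = D i i * t" using D tpow_odd by simp
    then have "D (- i) (- i) * D (a - c) (b - d) = D (- i) (- i) * (D i i * t)" by simp
    then have "D (- i + (a - c)) (- i + (b - d)) = t"
      using t_carrier carrier_G[OF t_carrier] by (simp only: D_mult D_D_mult) (simp add: D_zero)
    then show ?thesis using D_neq_t by blast
  qed
qed

lemma w_conj_t: "t * w_mat k * inv\<^bsub>G\<^esub> t = D (- 1) 0 * t"
  using t_carrier D_carrier by (simp add: w_eq G.m_assoc t_D_mult)

lemma simple_reflections_eq: "simple_reflections \<pi> k = {D 0 (- 1) * t, D (- 1) 0 * t}"
  by (simp add: simple_reflections_def w_conj_t) (simp add: w_eq)

section \<open>The length function\<close>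

text \<open>For the two simple reflections, left multiplication thus swaps the exponents and lowers
  one of them by 1, which changes \<open>\<bar>a - b\<bar>\<close> by exactly one.\<close>

lemma reflection_mult:
  "D x y * t * (D a b * tpow e) = D (x + b) (y + a) * tpow (e + 1)"
proof -
  have "tpow (e + 1) = t * tpow e" using tpow_add[of 1 e] by (simp add: tpow_one add.commute)
  then show ?thesis
    using t_carrier D_carrier tpow_carrier by (simp add: G.m_assoc t_D_mult D_D_mult)
qed

lemma reflection_word_eq:
  assumes "set ss \<subseteq> simple_reflections \<pi> k"
  shows "\<exists>a b e. foldr (*) ss (1\<^sub>m (2 * k)) = D a b * tpow e \<and> \<bar>a - b\<bar> \<le> int (length ss)"
  using assms
proof (induction ss)
  case Nil
  have "1\<^sub>m (2 * k) = D 0 0 * tpow 0" by (simp add: D_zero)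
  then show ?case by (intro exI[of _ 0]) simp
next
  case (Cons s ss)
  then obtain a b e where IH: "foldr (*) ss (1\<^sub>m (2 * k)) = D a b * tpow e" "\<bar>a - b\<bar> \<le> int (length ss)"
    by auto
  have "s = D 0 (- 1) * t \<or> s = D (- 1) 0 * t" using Cons by (auto simp: simple_reflections_eq)
  then show ?case
  proof
    assume "s = D 0 (- 1) * t"
    then have "foldr (*) (s # ss) (1\<^sub>m (2 * k)) = D b (a - 1) * tpow (e + 1)"
      by (simp add: IH reflection_mult)
    with IH show ?thesis by (intro exI[of _ b] exI[of _ "a - 1"] exI[of _ "e + 1"]) simp
  next
    assume "s = D (- 1) 0 * t"
    then have "foldr (*) (s # ss) (1\<^sub>m (2 * k)) = D (b - 1) a * tpow (e + 1)"
      by (simp add: IH reflection_mult)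
    with IH show ?thesis by (intro exI[of _ "b - 1"] exI[of _ a] exI[of _ "e + 1"]) simp
  qed
qed

lemma foldr_carrier: "set ss \<subseteq> carrier G \<Longrightarrow> foldr (*) ss (1\<^sub>m (2 * k)) \<in> carrier G"
  by (induction ss) auto

lemma simple_reflections_carrier: "simple_reflections \<pi> k \<subseteq> carrier G"
  using D_carrier t_carrier by (simp add: simple_reflections_eq)

text \<open>As long as the exponents differ, one of the two reflections brings them closer by one,
  so the word is built greedily.\<close>

lemma reflection_word_exists:
  assumes "\<bar>a - b\<bar> = int n"
  shows "\<exists>ss j. length ss = n \<and> set ss \<subseteq> simple_reflections \<pi> k \<and>
    D a b * tpow e = foldr (*) ss (1\<^sub>m (2 * k)) * tpow j"
  using assms
proof (induction n arbitrary: a b e)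
  case 0
  \<comment> \<open>Here \<open>a = b\<close>, and the scalar \<open>D a a\<close> is absorbed as
    \<open>tpow (2 * a)\<close>.\<close>
  then have "D a b * tpow e = foldr (*) [] (1\<^sub>m (2 * k)) * tpow (2 * a + e)"
    using tpow_carrier D_carrier by (simp add: tpow_add tpow_even)
  then show ?case by (intro exI[of _ "[]"]) auto
next
  case (Suc n)
  \<comment> \<open>The witnesses solve \<open>reflection_mult\<close> for the right factor; the
    sign of \<open>a - b\<close> decides which reflection shortens the element.\<close>
  obtain s c d where s: "s \<in> simple_reflections \<pi> k" "D a b * tpow e = s * (D c d * tpow (e - 1))"
    "\<bar>c - d\<bar> = int n"
  proof (cases "a > b")
    case True
    with Suc.prems show ?thesis
      by (intro that[of "D 0 (- 1) * t" "b + 1" a]) (auto simp: simple_reflections_eq reflection_mult)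
  next
    case False
    with Suc.prems show ?thesis
      by (intro that[of "D (- 1) 0 * t" b "a + 1"]) (auto simp: simple_reflections_eq reflection_mult)
  qed
  obtain ss j where ss: "length ss = n" "set ss \<subseteq> simple_reflections \<pi> k"
    "D c d * tpow (e - 1) = foldr (*) ss (1\<^sub>m (2 * k)) * tpow j"
    using Suc.IH[OF s(3)] by blast
  have "D a b * tpow e = foldr (*) (s # ss) (1\<^sub>m (2 * k)) * tpow j"
    unfolding s(2) ss(3)
    using foldr_carrier[of ss] ss(2) s(1) simple_reflections_carrier tpow_carrier
    by (simp add: G.m_assoc subset_iff)
  with ss s(1) show ?case by (intro exI[of _ "s # ss"] exI[of _ j]) auto
qed

text \<open>The greedy word attains this length. Conversely, a word of length \<open>n\<close>
  yields exponents at distance at most \<open>n\<close>, and by \<open>D_tpow_eq\<close> that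
  distance depends only on the element.\<close>

lemma W_length_D_tpow: "W_length \<pi> k (D a b * tpow e) = nat \<bar>a - b\<bar>"
  unfolding W_length_def GL_simps
proof (rule Least_equality)
  show "\<exists>ss j. length ss = nat \<bar>a - b\<bar> \<and> set ss \<subseteq> simple_reflections \<pi> k \<and>
      D a b * tpow e = foldr (*) ss (1\<^sub>m (2 * k)) * tpow j"
    by (rule reflection_word_exists) simp
next
  fix n assume "\<exists>ss j. length ss = n \<and> set ss \<subseteq> simple_reflections \<pi> k \<and>
      D a b * tpow e = foldr (*) ss (1\<^sub>m (2 * k)) * tpow j"
  then obtain ss j where ss: "length ss = n" "set ss \<subseteq> simple_reflections \<pi> k"
    "D a b * tpow e = foldr (*) ss (1\<^sub>m (2 * k)) * tpow j" by blast
  obtain c d f where cd: "foldr (*) ss (1\<^sub>m (2 * k)) = D c d * tpow f" "\<bar>c - d\<bar> \<le> int n"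
    using reflection_word_eq[OF ss(2)] ss(1) by blast
  have "D a b * tpow e = D c d * tpow (f + j)"
    unfolding ss(3) cd(1) tpow_add using D_carrier tpow_carrier by (simp add: G.m_assoc)
  then have "a - b = c - d" by (rule D_tpow_eq)
  with cd(2) show "nat \<bar>a - b\<bar> \<le> n" by simp
qed

lemma W_length_tpow_D_tpow: "W_length \<pi> k (tpow e * D a b * tpow f) = nat \<bar>a - b\<bar>"
proof -
  have "tpow e * D a b * tpow f = (if even e then D a b else D b a) * tpow (e + f)"
    unfolding tpow_D tpow_add using D_carrier tpow_carrier by (simp add: G.m_assoc)
  then show ?thesis by (simp add: W_length_D_tpow abs_minus_commute)
qed

section \<open>Normal form in \<open>W\<close> and the product formula\<close>

text \<open>The generators have this form, \<open>w_mat k\<close> being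
  \<open>D 0 (- 1) * t\<close>, and moving powers of \<open>t\<close> past diagonal elements shows
  closure under products and inverses.\<close>

lemma W_form:
  assumes "\<eta> \<in> W \<pi> k"
  shows "\<exists>a b e. \<eta> = D a b * tpow e"
proof -
  have inc: "\<exists>a b e. h = D a b * tpow e" if "h \<in> insert (w_mat k) {D a b |a b. True}" for h
  proof -
    from that consider "h = w_mat k" | a b where "h = D a b" by blast
    then show ?thesis
    proof cases
      case 1
      then have "h = D 0 (- 1) * tpow 1" by (simp add: w_eq tpow_one)
      then show ?thesis by blast
    next
      case 2
      then have "h = D a b * tpow 0" using D_carrier by simp
      then show ?thesis by blast
    qed
  qed
  have mult: "\<exists>a b e. x * y = D a b * tpow e"
    if xy: "\<exists>a b e. x = D a b * tpow e" "\<exists>a b e. y = D a b * tpow e" for x y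
  proof -
    obtain a b e c d f where x: "x = D a b * tpow e" "y = D c d * tpow f" using xy by blast
    obtain c' d' where c: "tpow e * D c d = D c' d' * tpow e" using tpow_D_commute by blast
    have "x * y = D a b * ((tpow e * D c d) * tpow f)"
      unfolding x using D_carrier tpow_carrier by (simp add: G.m_assoc)
    also have "\<dots> = D (a + c') (b + d') * tpow (e + f)"
      unfolding c tpow_add using D_carrier tpow_carrier by (simp add: G.m_assoc D_D_mult)
    finally show ?thesis by blast
  qed
  have inverse: "\<exists>a b e. inv\<^bsub>G\<^esub> x = D a b * tpow e" if ex: "\<exists>a b e. x = D a b * tpow e" for x
  proof -
    obtain a b e where x: "x = D a b * tpow e" using ex by blast
    have "inv\<^bsub>G\<^esub> x = tpow (- e) * D (- a) (- b)"
      unfolding x using D_carrier tpow_carrier t_carrier by (simp add: G.inv_mult_group inv_D G.int_pow_neg)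
    then show ?thesis using tpow_D_commute by metis
  qed
  show ?thesis
    using assms unfolding W_def
  proof (induction rule: generate.induct)
    case one
    have "\<one>\<^bsub>G\<^esub> = D 0 0 * tpow 0" by (simp add: D_zero)
    then show ?case by blast
  next
    case (incl h) then show ?case by (rule inc)
  next
    case (inv h) then show ?case by (rule inverse[OF inc])
  next
    case (eng h1 h2) then show ?case using mult by simp
  qed
qed

lemma tpow_normalizing: "tpow e \<in> normalizing G P"
  using G.subgroup_int_pow_closed[OF G.subgroup_normalizing[OF subgroup_P] t_normalizing] .

lemma hecke_conv_of_length_add:
  assumes "\<eta> \<in> W \<pi> k" "\<delta> \<in> W \<pi> k" "W_length \<pi> k (\<eta> * \<delta>) = W_length \<pi> k \<eta> + W_length \<pi> k \<delta>"
  shows "hecke_conv G P (hecke_char G P \<eta>) (hecke_char G P \<delta>) = hecke_char G P (\<eta> * \<delta>)"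
proof -
  \<comment> \<open>The power of \<open>t\<close> is placed on the left in \<eta> but on the right
    in \<delta>, so that the diagonal parts become adjacent in the product.\<close>
  obtain a b e where \<eta>: "\<eta> = tpow e * D a b" using W_form[OF assms(1)] D_tpow_commute by metis
  obtain c d f where \<delta>: "\<delta> = D c d * tpow f" using W_form[OF assms(2)] by blast
  note cl = D_carrier tpow_carrier t_carrier
  have "\<eta> * \<delta> = tpow e * D (a + c) (b + d) * tpow f"
    unfolding \<eta> \<delta> using cl by (simp add: G.m_assoc D_D_mult)
  then have "W_length \<pi> k (\<eta> * \<delta>) = nat \<bar>(a + c) - (b + d)\<bar>"
    by (simp add: W_length_tpow_D_tpow)
  moreover have "W_length \<pi> k \<eta> = nat \<bar>a - b\<bar>"
    using W_length_tpow_D_tpow[of e a b 0] cl carrier_G[of \<eta>] unfolding \<eta> by simp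
  moreover have "W_length \<pi> k \<delta> = nat \<bar>c - d\<bar>" unfolding \<delta> by (rule W_length_D_tpow)
  ultimately have "nat \<bar>(a + c) - (b + d)\<bar> = nat \<bar>a - b\<bar> + nat \<bar>c - d\<bar>"
    using assms(3) by simp
  \<comment> \<open>Additivity of absolute values forces \<open>a - b\<close> and
    \<open>c - d\<close> not to have opposite signs.\<close>
  then consider "a \<le> b" "c \<le> d" | "b \<le> a" "d \<le> c" by linarith
  then show ?thesis
  proof cases
    case 1
    have "\<eta> = tpow e * D a b * tpow 0" "\<delta> = inv\<^bsub>G\<^esub> tpow 0 * D c d * tpow f"
      unfolding \<eta> \<delta> using cl carrier_G[OF D_carrier] by (simp_all add: G.m_assoc)
    then show ?thesis using hecke_conv_D[OF 1 tpow_normalizing tpow_normalizing tpow_normalizing] by metis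
  next
    case 2
    \<comment> \<open>Conjugation by \<open>t\<close> reverses the exponents, reducing to the
      increasing case. The inner \<open>inv t\<close> and \<open>t\<close> take the places of
      \<open>m\<close> and its inverse in \<open>hecke_conv_D\<close>.\<close>
    have D: "D x y = t * D y x * inv\<^bsub>G\<^esub> t" for x y
      unfolding t_D using cl by (simp add: G.m_assoc)
    have "inv\<^bsub>G\<^esub> tpow (- 1) = t" "tpow (- 1) = inv\<^bsub>G\<^esub> t" using cl by (simp_all add: G.int_pow_neg)
    moreover have "\<eta> = tpow e * (t * D b a * inv\<^bsub>G\<^esub> t)" "\<delta> = t * D d c * inv\<^bsub>G\<^esub> t * tpow f"
      unfolding \<eta> \<delta> D[symmetric] by simp_all
    ultimately have "\<eta> = tpow (e + 1) * D b a * tpow (- 1)"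
      "\<delta> = inv\<^bsub>G\<^esub> tpow (- 1) * D d c * tpow (- 1 + f)"
      unfolding tpow_add tpow_one using cl by (simp_all add: G.m_assoc)
    then show ?thesis using hecke_conv_D[OF 2 tpow_normalizing tpow_normalizing tpow_normalizing] by metis
  qed
qed

end

theorem theorem3p10:
  fixes v :: "'a::field \<Rightarrow> int" and \<pi> :: 'a and k :: nat and \<eta> \<delta> :: "'a mat"
  assumes "nonarch_local_field v"
    and "is_uniformizer v \<pi>"
    and "0 < k"
    and "\<eta> \<in> W \<pi> k" and "\<delta> \<in> W \<pi> k"
    and "W_length \<pi> k (\<eta> \<otimes>\<^bsub>GL (2 * k)\<^esub> \<delta>) = W_length \<pi> k \<eta> + W_length \<pi> k \<delta>"
  shows "hecke_char (GL (2 * k)) (parahoric v k) \<eta>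
           \<otimes>\<^bsub>hecke_algebra (GL_topology v (2 * k)) (GL (2 * k)) (parahoric v k)\<^esub>
         hecke_char (GL (2 * k)) (parahoric v k) \<delta>
       = hecke_char (GL (2 * k)) (parahoric v k) (\<eta> \<otimes>\<^bsub>GL (2 * k)\<^esub> \<delta>)"
proof -
  interpret nonarch_local_field v by fact
  interpret parahoric_setting v \<pi> k by unfold_locales fact+
  show ?thesis
    using hecke_conv_of_length_add[OF assms(4,5)] assms(6) by (simp add: hecke_algebra_def)
qed

end
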